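(* Let $m,\alpha,\beta>0$ and let $\mathrm{Q}\in\{\mathbb{R}^2_{+-},\mathbb{R}^2_{-+}\}$. Then the set $\Lambda_{\alpha,\beta}\cap\bar{\mathrm{Q}}$ is not a $\bar{\mathrm{Q}}$-local Fourier uniqueness set for $\mathrm{ACH}(\Gamma_m)$. In particular, $\Lambda_{\alpha,\beta}\cap\bar{\mathrm{Q}}$ is not a Fourier uniqueness set for $\mathrm{ACH}(\Gamma_m)$.
   Context: For a finite complex-valued Borel measure $\mu$ on $\mathbb{R}^2$, the Fourier transform is $\widehat\mu(\xi)=\int_{\mathbb{R}^2}e^{\pi i\langle x,\xi\rangle}\,d\mu(x)$ for $\xi\in\mathbb{R}^2$, where $\langle x,\xi\rangle=x_1\xi_1+x_2\xi_2$. For $m>0$, $\Gamma_m=\{x\in\mathbb{R}^2: x_1x_2=-m^2/(4\pi^2)\}$. Definition of $\mathrm{ACH}(\Gamma_m)$: for a finite complex Borel measure $\mu$ supported on $\Gamma_m$, its compression to the $x_1$-axis is the measure $\boldsymbol\pi_1\mu(A)=\mu(A\times\mathbb{R})$ on $\mathbb{R}$; $\mu$ is absolutely continuous with respect to arc length on $\Gamma_m$ iff $\boldsymbol\pi_1\mu$ is absolutely continuous with respect to Lebesgue measure. $\mathrm{AC}_0(\Gamma_m)$ is the space of those $\mu$ that are absolutely continuous with respect to arc length and satisfy $\mu(\mathbb{R}^2)=0$. The Hilbert transform on $\mathbb{R}$ is $\mathbf{H}[f](x)=\mathrm{pv}\,\frac1\pi\int_{\mathbb{R}}\frac{f(t)}{x-t}\,dt$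 (as a distribution), and the Hilbert transform $\mathbf{H}_{\Gamma_m}$ on $\Gamma_m$ is the one corresponding to $\mathbf{H}$ under $\boldsymbol\pi_1$, i.e. $\boldsymbol\pi_1\mathbf{H}_{\Gamma_m}[\mu]=\mathbf{H}[\boldsymbol\pi_1\mu]$. $\mathrm{ACH}(\Gamma_m)$ is the space of $\mu\in\mathrm{AC}_0(\Gamma_m)$ with $\mathbf{H}_{\Gamma_m}[\mu]\in\mathrm{AC}_0(\Gamma_m)$. Equivalently, $\mu\in\mathrm{ACH}(\Gamma_m)$ iff $d\boldsymbol\pi_1\mu(t)=f(t)\,dt$ with $f\in L^1(\mathbb{R})$, $\int_{\mathbb{R}} f=0$, $\mathbf{H}[f]\in L^1(\mathbb{R})$ and $\int_{\mathbb{R}}\mathbf{H}[f]=0$. For $\alpha,\beta>0$, the lattice-cross is $\Lambda_{\alpha,\beta}=(\alpha\mathbb{Z}\times\{0\})\cup(\{0\}\times\beta\mathbb{Z})\subset\mathbb{R}^2$. $\mathbb{R}^2_{+-}=\{\xi\in\mathbb{R}^2:\xi_1>0,\ \xi_2<0\}$ and $\mathbb{R}^2_{-+}=\{\xi\in\mathbb{R}^2:\xi_1<0,\ \xi_2>0\}$ (the time-like quadrants); $\bar{\mathrm{Q}}$ is the closure of $\mathrm{Q}$. A set $\Lambda\subset\mathbb{R}^2$ is a Fourier uniqueness set for a linear space $X$ of finite complex Borel measures on $\mathbb{R}^2$ if every $\mu\in X$ with $\widehat\mu|_\Lambda=0$ satisfies $\mu=0$. For $\Lambda\subset\mathrm{K}\subset\mathbb{R}^2$,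 $\Lambda$ is a $\mathrm{K}$-local Fourier uniqueness set for $X$ if every $\mu\in X$ with $\widehat\mu|_\Lambda=0$ satisfies $\widehat\mu|_{\mathrm{K}}=0$. *)

theory Defs
  imports "HOL-Analysis.Analysis"
begin

section \<open>Finite complex Borel measures\<close>

text \<open>
  Complex measures are countably additive set functions on the Borel sets.  They are normalised to
  vanish outside the Borel sets, so that equality of functions is equality of measures and the zero
  measure is \<^term>\<open>\<lambda>_. 0\<close>.
\<close>

definition complex_measure :: "('a::topological_space set \<Rightarrow> complex) \<Rightarrow> bool" where
  "complex_measure \<mu> \<longleftrightarrow>
     (\<forall>A. A \<notin> sets borel \<longrightarrow> \<mu> A = 0) \<and>
     (\<forall>A :: nat \<Rightarrow> 'a set. range A \<subseteq> sets borel \<longrightarrow> disjoint_family A \<longrightarrow>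
        (\<lambda>i. \<mu> (A i)) sums \<mu> (\<Union>i. A i))"

text \<open>
  The positive part in the Jordan decomposition of a real signed measure:
  \<open>\<nu>\<^sup>+(A) = sup {\<nu>(B) | B \<subseteq> A Borel}\<close>.  The coercion \<^const>\<open>ennreal\<close> sends negative values to \<open>0\<close>,
  which does not change the supremum because \<open>B = {}\<close> is admitted.
\<close>

definition jordan_pos :: "('a::topological_space set \<Rightarrow> real) \<Rightarrow> 'a measure" where
  "jordan_pos \<nu> = measure_of UNIV (sets borel) (\<lambda>A. SUP B\<in>{B \<in> sets borel. B \<subseteq> A}. ennreal (\<nu> B))"

definition complex_integral ::
    "('a::topological_space set \<Rightarrow> complex) \<Rightarrow> ('a \<Rightarrow> complex) \<Rightarrow> complex" where
  "complex_integral \<mu> f =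
     (integral\<^sup>L (jordan_pos (\<lambda>A. Re (\<mu> A))) f - integral\<^sup>L (jordan_pos (\<lambda>A. - Re (\<mu> A))) f)
     + \<i> * (integral\<^sup>L (jordan_pos (\<lambda>A. Im (\<mu> A))) f - integral\<^sup>L (jordan_pos (\<lambda>A. - Im (\<mu> A))) f)"

lemma jordan_pos_density:
  fixes g :: "'a::topological_space \<Rightarrow> real"
  assumes M: "sets M = sets borel" and g: "integrable M g"
  shows "jordan_pos (\<lambda>A. \<integral>x\<in>A. g x \<partial>M) = density M (\<lambda>x. ennreal (g x))"
proof -
  let ?D = "density M (\<lambda>x. ennreal (g x))"
  have gm: "g \<in> borel_measurable M" using g by simp
  have sp: "space M = UNIV" using sets_eq_imp_space_eq[OF M] by simp
  have int: "set_integrable M A g" if "A \<in> sets M" for A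
    unfolding set_integrable_def by (rule integrable_mult_indicator[OF that g])
  have le: "ennreal (\<integral>x\<in>B. g x \<partial>M) \<le> emeasure ?D B" if B: "B \<in> sets M" for B
  proof -
    have "ennreal (\<integral>x\<in>B. g x \<partial>M) \<le> ennreal (\<integral>x. indicator B x * max 0 (g x) \<partial>M)"
      unfolding set_lebesgue_integral_def
    proof (intro ennreal_leI integral_mono)
      show "integrable M (\<lambda>x. indicator B x *\<^sub>R g x)"
        using int[OF B] by (simp add: set_integrable_def)
      show "integrable M (\<lambda>x. indicator B x * max 0 (g x))"
        using integrable_mult_indicator[OF B, of "\<lambda>x. max 0 (g x)"] g by simp
    qed (auto simp: indicator_def)
    also have "\<dots> = (\<integral>\<^sup>+x. ennreal (indicator B x * max 0 (g x)) \<partial>M)"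
      using integrable_mult_indicator[OF B, of "\<lambda>x. max 0 (g x)"] g
      by (intro nn_integral_eq_integral[symmetric]) auto
    also have "\<dots> = emeasure ?D B"
      using B gm by (subst emeasure_density)
        (auto intro!: nn_integral_cong simp: indicator_def max_def ennreal_neg)
    finally show ?thesis .
  qed
  have eq: "(SUP B\<in>{B \<in> sets borel. B \<subseteq> A}. ennreal (\<integral>x\<in>B. g x \<partial>M)) = emeasure ?D A"
    if A: "A \<in> sets borel" for A
  proof (rule antisym)
    have A': "A \<in> sets ?D" using A M by simp
    show "(SUP B\<in>{B \<in> sets borel. B \<subseteq> A}. ennreal (\<integral>x\<in>B. g x \<partial>M)) \<le> emeasure ?D A"
      by (rule SUP_least) (use le M A' in \<open>auto intro: order_trans[OF le emeasure_mono]\<close>)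
    let ?P = "A \<inter> {x \<in> space M. 0 < g x}"
    have P: "?P \<in> sets M" using A M gm by (intro sets.Int) auto
    have "emeasure ?D A = (\<integral>\<^sup>+x. ennreal (indicator ?P x * g x) \<partial>M)"
      using A M gm sp by (subst emeasure_density)
        (auto intro!: nn_integral_cong simp: indicator_def ennreal_neg)
    also have "\<dots> = ennreal (\<integral>x\<in>?P. g x \<partial>M)"
      unfolding set_lebesgue_integral_def real_scaleR_def
      using int[OF P] by (intro nn_integral_eq_integral)
        (auto simp: set_integrable_def indicator_def)
    also have "\<dots> \<le> (SUP B\<in>{B \<in> sets borel. B \<subseteq> A}. ennreal (\<integral>x\<in>B. g x \<partial>M))"
      by (rule SUP_upper) (use P M in auto)
    finally show "emeasure ?D A \<le> (SUP B\<in>{B \<in> sets borel. B \<subseteq> A}. ennreal (\<integral>x\<in>B. g x \<partial>M))" .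
  qed
  have "jordan_pos (\<lambda>A. \<integral>x\<in>A. g x \<partial>M) = measure_of UNIV (sets borel) (emeasure ?D)"
    unfolding jordan_pos_def
    by (rule measure_of_eq) (auto simp: eq sets.sigma_sets_eq[of "borel", simplified])
  also have "\<dots> = ?D"
    using measure_of_of_measure[of ?D] M sp by simp
  finally show ?thesis .
qed

definition fourier :: "((real \<times> real) set \<Rightarrow> complex) \<Rightarrow> real \<times> real \<Rightarrow> complex" where
  "fourier \<mu> \<xi> = complex_integral \<mu> (\<lambda>x. exp (\<i> * of_real (pi * (x \<bullet> \<xi>))))"


section \<open>The hyperbola and measures on it\<close>

definition Gamma :: "real \<Rightarrow> (real \<times> real) set" where
  "Gamma m = {x. fst x * snd x = - (m\<^sup>2 / (4 * pi\<^sup>2))}"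

definition supported_on :: "('a::topological_space set \<Rightarrow> complex) \<Rightarrow> 'a set \<Rightarrow> bool" where
  "supported_on \<mu> S \<longleftrightarrow> (\<forall>A \<in> sets borel. A \<inter> S = {} \<longrightarrow> \<mu> A = 0)"

text \<open>
  Arc length on the graph of \<open>g t = - m\<^sup>2 / (4 \<pi>\<^sup>2 t)\<close> is the image of \<open>sqrt (1 + (g' t)\<^sup>2) dt\<close>.  The
  parameter \<open>t = 0\<close>, where \<open>g\<close> is undefined, is a Lebesgue null set.
\<close>

definition arc_length :: "real \<Rightarrow> (real \<times> real) measure" where
  "arc_length m =
     distr (density lborel (\<lambda>t. ennreal (sqrt (1 + (m\<^sup>2 / (4 * pi\<^sup>2 * t\<^sup>2))\<^sup>2)))) borel
       (\<lambda>t. (t, - (m\<^sup>2 / (4 * pi\<^sup>2 * t))))"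

definition abs_cont :: "('a::topological_space set \<Rightarrow> complex) \<Rightarrow> 'a measure \<Rightarrow> bool" where
  "abs_cont \<mu> M \<longleftrightarrow> (\<forall>A \<in> sets borel. emeasure M A = 0 \<longrightarrow> \<mu> A = 0)"

definition compression :: "((real \<times> real) set \<Rightarrow> complex) \<Rightarrow> real set \<Rightarrow> complex" where
  "compression \<mu> A = \<mu> (A \<times> UNIV)"

lemma abs_cont_arc_length_iff:
  assumes supp: "supported_on \<mu> (Gamma m)" and cm: "complex_measure \<mu>" and m: "m > 0"
  shows "abs_cont \<mu> (arc_length m) \<longleftrightarrow> abs_cont (compression \<mu>) lborel"
proof -
  let ?s = "\<lambda>t::real. ennreal (sqrt (1 + (m\<^sup>2 / (4 * pi\<^sup>2 * t\<^sup>2))\<^sup>2))"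
  let ?p = "\<lambda>t::real. (t, - (m\<^sup>2 / (4 * pi\<^sup>2 * t)))"
  have pm: "?p \<in> borel_measurable borel" by (intro borel_measurable_Pair) measurable
  have pv: "?p -` A \<in> sets borel" if "A \<in> sets borel" for A
    using measurable_sets[OF pm that] by simp
  have null: "emeasure (arc_length m) A = 0 \<longleftrightarrow> emeasure lborel (?p -` A) = 0"
    if A: "A \<in> sets borel" for A
  proof -
    have dens: "emeasure (arc_length m) A = emeasure (density lborel ?s) (?p -` A)"
      using A pm unfolding arc_length_def by (subst emeasure_distr) auto
    have pos: "?s t \<noteq> 0" for t
    proof -
      have "0 < sqrt (1 + (m\<^sup>2 / (4 * pi\<^sup>2 * t\<^sup>2))\<^sup>2)"
        by (simp add: add_pos_nonneg)
      then show ?thesis by (simp add: ennreal_eq_0_iff)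
    qed
    have "emeasure (arc_length m) A = 0 \<longleftrightarrow> ?p -` A \<in> null_sets (density lborel ?s)"
      using pv[OF A] by (simp add: dens null_sets_def)
    also have "\<dots> \<longleftrightarrow> (AE t in lborel. t \<notin> ?p -` A)"
      using pv[OF A] pos by (subst null_sets_density_iff) auto
    also have "\<dots> \<longleftrightarrow> emeasure lborel (?p -` A) = 0"
      using pv[OF A] by (subst AE_iff_measurable[of "?p -` A"]) auto
    finally show ?thesis .
  qed
  have empty: "\<mu> {} = 0" using supp by (simp add: supported_on_def)
  have add: "\<mu> (A \<union> B) = \<mu> A + \<mu> B" if "A \<in> sets borel" "B \<in> sets borel" "A \<inter> B = {}" for A B
  proof -
    have "(\<lambda>i. \<mu> (binaryset A B i)) sums \<mu> (\<Union>i. binaryset A B i)"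
    proof -
      have "range (binaryset A B) \<subseteq> sets borel"
        using that by (auto simp: range_binaryset_eq)
      moreover have "disjoint_family (binaryset A B)"
        using that by (auto simp: disjoint_family_on_def binaryset_def)
      ultimately show ?thesis using cm unfolding complex_measure_def by blast
    qed
    moreover have "(\<lambda>i. \<mu> (binaryset A B i)) sums (\<mu> A + \<mu> B)"
      by (rule binaryset_sums) (rule empty)
    ultimately have "\<mu> (\<Union>i. binaryset A B i) = \<mu> A + \<mu> B"
      by (rule sums_unique2)
    then show ?thesis by (simp only: UN_binaryset_eq)
  qed
  have restr: "\<mu> A = \<mu> B" if A: "A \<in> sets borel" and B: "B \<in> sets borel"
    and AB: "A \<inter> Gamma m = B \<inter> Gamma m" for A B
  proof -
    have "\<mu> ((A \<inter> B) \<union> (A - B)) = \<mu> (A \<inter> B) + \<mu> (A - B)"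
      using A B by (intro add) auto
    moreover have "\<mu> ((A \<inter> B) \<union> (B - A)) = \<mu> (A \<inter> B) + \<mu> (B - A)"
      using A B by (intro add) auto
    moreover have "(A - B) \<inter> Gamma m = {}" "(B - A) \<inter> Gamma m = {}"
      using AB by blast+
    then have "\<mu> (A - B) = 0" "\<mu> (B - A) = 0"
      using supp A B unfolding supported_on_def by blast+
    moreover have "(A \<inter> B) \<union> (A - B) = A" "(A \<inter> B) \<union> (B - A) = B" by auto
    ultimately show ?thesis by simp
  qed
  have graph: "x = ?p (fst x)" if "x \<in> Gamma m" for x
  proof (rule prod_eqI)
    define c where "c = m\<^sup>2 / (4 * pi\<^sup>2)"
    have eq: "fst x * snd x = - c" using that by (simp add: Gamma_def c_def)
    have "c > 0" using m by (simp add: c_def)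
    with eq have "fst x \<noteq> 0" by auto
    with eq have "snd x = - (c / fst x)" by (simp add: field_simps)
    then show "snd x = snd (?p (fst x))" by (simp add: c_def)
  qed simp
  have cyl: "C \<times> UNIV \<in> sets (borel :: (real \<times> real) measure)" if "C \<in> sets borel" for C :: "real set"
    unfolding borel_prod[symmetric] using that by (intro pair_measureI) auto
  show ?thesis
  proof
    assume L: "abs_cont \<mu> (arc_length m)"
    show "abs_cont (compression \<mu>) lborel"
      unfolding abs_cont_def
    proof (intro ballI impI)
      fix C :: "real set" assume C: "C \<in> sets borel" "emeasure lborel C = 0"
      have "?p -` (C \<times> UNIV) = C" by auto
      then show "compression \<mu> C = 0"
        using L C cyl[OF C(1)] null[OF cyl[OF C(1)]] by (simp add: abs_cont_def compression_def)
    qed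
  next
    assume R: "abs_cont (compression \<mu>) lborel"
    show "abs_cont \<mu> (arc_length m)"
      unfolding abs_cont_def
    proof (intro ballI impI)
      fix A :: "(real \<times> real) set" assume A: "A \<in> sets borel" "emeasure (arc_length m) A = 0"
      have "\<mu> A = \<mu> ((?p -` A) \<times> UNIV)"
      proof (rule restr[OF A(1) cyl[OF pv[OF A(1)]]])
        show "A \<inter> Gamma m = (?p -` A \<times> UNIV) \<inter> Gamma m"
        proof (rule set_eqI)
          fix x :: "real \<times> real"
          show "x \<in> A \<inter> Gamma m \<longleftrightarrow> x \<in> (?p -` A \<times> UNIV) \<inter> Gamma m"
          proof (cases "x \<in> Gamma m")
            case True
            then have "x = ?p (fst x)" by (rule graph)
            then have "x \<in> A \<longleftrightarrow> ?p (fst x) \<in> A"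
              by (rule arg_cong[where f = "\<lambda>y. y \<in> A"])
            with True show ?thesis by (simp add: mem_Times_iff)
          qed simp
        qed
      qed
      then show "\<mu> A = 0"
        using R A pv[OF A(1)] null[OF A(1)] by (simp add: abs_cont_def compression_def)
    qed
  qed
qed

definition AC0 :: "real \<Rightarrow> ((real \<times> real) set \<Rightarrow> complex) set" where
  "AC0 m = {\<mu>. complex_measure \<mu> \<and> supported_on \<mu> (Gamma m) \<and>
               abs_cont \<mu> (arc_length m) \<and> \<mu> UNIV = 0}"


section \<open>Hilbert transform\<close>

definition test_function :: "(real \<Rightarrow> complex) \<Rightarrow> bool" where
  "test_function \<phi> \<longleftrightarrow>
     (\<forall>n. ((\<lambda>\<psi> x. vector_derivative \<psi> (at x)) ^^ n) \<phi> differentiable_on UNIV) \<and>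
     compact (closure {x. \<phi> x \<noteq> 0})"

definition hilbert :: "(real \<Rightarrow> complex) \<Rightarrow> real \<Rightarrow> complex" where
  "hilbert f x =
     Lim (at_right 0) (\<lambda>\<epsilon>. 1 / of_real pi * (LINT t:{t. \<epsilon> < \<bar>x - t\<bar>}|lborel. f t / of_real (x - t)))"

text \<open>
  The Hilbert transform of a finite complex measure \<open>\<rho>\<close> on the line, as a distribution.  The kernel
  \<open>pv 1 / (\<pi> x)\<close> is odd, so convolving with it is the transpose of minus itself:
  \<open>\<langle>H \<rho>, \<phi>\<rangle> = - \<integral> H \<phi> d\<rho>\<close>, where \<open>H \<phi>\<close> is a bounded continuous function.
\<close>

definition hilbert_distr :: "(real set \<Rightarrow> complex) \<Rightarrow> (real \<Rightarrow> complex) \<Rightarrow> complex" where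
  "hilbert_distr \<rho> \<phi> = - complex_integral \<rho> (hilbert \<phi>)"

text \<open>
  \<open>\<nu>\<close> is the Hilbert transform on the hyperbola of \<open>\<mu>\<close>: its compression, viewed as a distribution,
  is the Hilbert transform of the compression of \<open>\<mu>\<close>.
\<close>

definition is_hilbert_Gamma ::
    "((real \<times> real) set \<Rightarrow> complex) \<Rightarrow> ((real \<times> real) set \<Rightarrow> complex) \<Rightarrow> bool" where
  "is_hilbert_Gamma \<mu> \<nu> \<longleftrightarrow>
     (\<forall>\<phi>. test_function \<phi> \<longrightarrow>
        complex_integral (compression \<nu>) \<phi> = hilbert_distr (compression \<mu>) \<phi>)"

definition ACH :: "real \<Rightarrow> ((real \<times> real) set \<Rightarrow> complex) set" where
  "ACH m = {\<mu> \<in> AC0 m. \<exists>\<nu> \<in> AC0 m. is_hilbert_Gamma \<mu> \<nu>}"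


section \<open>Lattice-crosses and Fourier uniqueness\<close>

definition lattice_cross :: "real \<Rightarrow> real \<Rightarrow> (real \<times> real) set" where
  "lattice_cross \<alpha> \<beta> =
     range (\<lambda>j :: int. (\<alpha> * of_int j, 0)) \<union> range (\<lambda>k :: int. (0, \<beta> * of_int k))"

definition quadrant_pm :: "(real \<times> real) set" where
  "quadrant_pm = {\<xi>. fst \<xi> > 0 \<and> snd \<xi> < 0}"

definition quadrant_mp :: "(real \<times> real) set" where
  "quadrant_mp = {\<xi>. fst \<xi> < 0 \<and> snd \<xi> > 0}"

definition fourier_uniqueness_set ::
    "((real \<times> real) set \<Rightarrow> complex) set \<Rightarrow> (real \<times> real) set \<Rightarrow> bool" where
  "fourier_uniqueness_set X \<Lambda> \<longleftrightarrow>
     (\<forall>\<mu> \<in> X. (\<forall>\<xi> \<in> \<Lambda>. fourier \<mu> \<xi> = 0) \<longrightarrow> \<mu> = (\<lambda>_. 0))"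

definition local_fourier_uniqueness_set ::
    "(real \<times> real) set \<Rightarrow> ((real \<times> real) set \<Rightarrow> complex) set \<Rightarrow> (real \<times> real) set \<Rightarrow> bool" where
  "local_fourier_uniqueness_set K X \<Lambda> \<longleftrightarrow>
     (\<forall>\<mu> \<in> X. (\<forall>\<xi> \<in> \<Lambda>. fourier \<mu> \<xi> = 0) \<longrightarrow> (\<forall>\<xi> \<in> K. fourier \<mu> \<xi> = 0))"

end

theory Submission
  imports "HOL-Complex_Analysis.Complex_Analysis" "HOL-Probability.Sinc_Integral" Defs
begin

text \<open>
  On the time-like quadrant \<open>\<xi>\<^sub>1 \<ge> 0\<close>, \<open>\<xi>\<^sub>2 \<le> 0\<close> the characters restrict to the hyperbola
  \<open>t \<mapsto> (t, - c / t)\<close> as \<open>e\<^bsup>i\<pi>\<xi>\<^sub>1t\<^esup>\<close> on one axis and \<open>e\<^bsup>i\<pi>c|\<xi>\<^sub>2|/t\<^esup>\<close> on the other; the first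
  is bounded in the upper half-plane, the second in the lower one.  A density in the Hardy space
  \<open>H\<^sup>1\<close> of the lower half-plane therefore annihilates this half of the \<open>\<xi>\<^sub>2\<close>-axis, and it only remains to
  make its Fourier transform vanish on \<open>\<alpha>\<nat>\<close> but not on the \<open>\<xi>\<^sub>1\<close>-axis.  The density
  \<open>((1 - e\<^bsup>-ibt\<^esup>) / t)\<^sup>2\<close> with \<open>b = \<pi>\<alpha> / 2\<close> does this: its Fourier transform is a triangle function
  supported on \<open>[0, \<alpha>]\<close>.  Being in \<open>H\<^sup>1\<close>, it is an eigenfunction of the Hilbert transform, so it
  gives an element of \<open>ACH\<close>.  The other quadrant is obtained by the reflection \<open>t \<mapsto> - t\<close>.
\<close>

section \<open>Integrals over the line of functions holomorphic in the lower half-plane\<close>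

lemma integrable_lborel_inverse_1_plus_square: "integrable lborel (\<lambda>x::real. inverse (1 + x\<^sup>2))"
  and integral_lborel_inverse_1_plus_square: "(\<integral>x. inverse (1 + x\<^sup>2) \<partial>lborel) = pi"
  using integrable_inverse_1_plus_square LBINT_inverse_1_plus_square
  by (simp_all add: set_integrable_def interval_lebesgue_integral_def set_lebesgue_integral_def
      einterval_eq_UNIV)

lemma integrable_bounded_by_Cauchy_kernel:
  fixes g :: "real \<Rightarrow> complex"
  assumes "g \<in> borel_measurable borel" "\<And>x. norm (g x) \<le> C / (1 + x\<^sup>2)"
  shows "integrable lborel g"
proof (rule Bochner_Integration.integrable_bound)
  show "integrable lborel (\<lambda>x. C * inverse (1 + x\<^sup>2))"
    using integrable_lborel_inverse_1_plus_square by simp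
  show "AE x in lborel. norm (g x) \<le> norm (C * inverse (1 + x\<^sup>2))"
    using assms(2) by (auto simp: divide_inverse intro!: order_trans[OF assms(2)])
qed (use assms in simp)

text \<open>Cauchy's theorem on the segment from \<open>- R\<close> to \<open>R\<close> closed by
  the lower semicircle. The arc contributes at most \<open>C * R * pi / (1 + R\<^sup>2)\<close>,
  which tends to 0, while the segments exhaust the line by dominated convergence. Holomorphy up to
  height \<open>\<eta>\<close> puts the whole contour inside one open convex set.\<close>

lemma lower_half_plane_integral_eq_0:
  fixes g :: "complex \<Rightarrow> complex"
  assumes holo: "g holomorphic_on {z. Im z < \<eta>}" and "\<eta> > 0"
    and bound: "\<And>z. Im z \<le> 0 \<Longrightarrow> norm (g z) \<le> C / (1 + (norm z)\<^sup>2)"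
  shows "(\<integral>x. g (of_real x) \<partial>lborel) = 0"
proof -
  let ?S = "{z. Im z < \<eta>}"
  have C: "C \<ge> 0" using order_trans[OF norm_ge_zero bound[of 0]] by simp
  have cont: "continuous_on UNIV (\<lambda>x::real. g (of_real x))"
    by (rule continuous_on_compose2[OF holomorphic_on_imp_continuous_on[OF holo]])
      (use \<open>\<eta> > 0\<close> in \<open>auto intro!: continuous_intros\<close>)
  have meas: "(\<lambda>x::real. g (of_real x)) \<in> borel_measurable borel"
    by (rule borel_measurable_continuous_onI[OF cont])
  have bd: "norm (g (of_real x)) \<le> C / (1 + x\<^sup>2)" for x :: real
    using bound[of "of_real x"] by simp
  have int: "integrable lborel (\<lambda>x. g (of_real x))"
    by (rule integrable_bounded_by_Cauchy_kernel[OF meas bd])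
  have "norm (integral {-R..R} (\<lambda>x. g (of_real x))) \<le> C / (1 + R\<^sup>2) * R * pi" if "R > 0" for R :: real
  proof -
    let ?l = "linepath (of_real (-R)) (of_real R :: complex)"
    \<comment> \<open>Running the angle from 0 down to \<open>- pi\<close> leads from
      \<open>R\<close> clockwise through the lower half-plane to \<open>- R\<close>, which closes
      the segment.\<close>
    let ?c = "part_circlepath 0 R 0 (-pi)"
    have imc: "Im z \<le> 0 \<and> norm z = R" if "z \<in> path_image ?c" for z
    proof -
      obtain x where x: "x \<in> {-pi..0}" "z = R * cis x"
        using \<open>z \<in> path_image ?c\<close>
        by (auto simp: path_image_part_circlepath' closed_segment_eq_real_ivl split: if_splits)
      have "sin x \<le> 0" using sin_ge_zero[of "-x"] x by simp
      then show ?thesis using x \<open>R > 0\<close> by (auto simp: norm_mult mult_nonneg_nonpos)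
    qed
    have e: "pathfinish ?l = pathstart ?c" "pathfinish ?c = pathstart ?l"
      by (simp_all add: exp_minus flip: mult.commute[of pi])
    have sub: "path_image ?l \<subseteq> ?S" "path_image ?c \<subseteq> ?S"
      using imc \<open>\<eta> > 0\<close> by (auto simp: path_image_linepath closed_segment_def) force
    have cv: "convex ?S" by (rule convex_halfspace_Im_lt)
    have z0: "(g has_contour_integral 0) (?l +++ ?c)"
      by (rule Cauchy_theorem_convex_simple[OF holo cv])
        (use e sub in \<open>auto intro!: valid_path_join simp: path_image_join\<close>)
    have op: "open ?S" by (rule open_halfspace_Im_lt)
    have il: "g contour_integrable_on ?l" "g contour_integrable_on ?c"
      by (rule contour_integrable_holomorphic_simple[OF holo op]; use sub in auto)+
    have "contour_integral ?l g + contour_integral ?c g = 0"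
      using contour_integral_unique[OF z0] il e by simp
    then have "norm (contour_integral ?l g) = norm (contour_integral ?c g)"
      by (metis add.inverse_unique norm_minus_cancel)
    also have "\<dots> \<le> C / (1 + R\<^sup>2) * R * \<bar>-pi - 0\<bar>"
      by (rule contour_integral_bound_part_circlepath[OF il(2)])
        (use imc bound C \<open>R > 0\<close> in \<open>force intro!: divide_nonneg_nonneg\<close>)+
    also have "contour_integral ?l g = integral {-R..R} (\<lambda>x. g (of_real x))"
      using \<open>R > 0\<close> by (subst contour_integral_linepath_Reals_eq) auto
    finally show ?thesis by simp
  qed note arc = this
  let ?I = "\<lambda>n::nat. \<integral>x. indicator {-real n..real n} x *\<^sub>R g (of_real x) \<partial>lborel"
  have lim1: "?I \<longlonglongrightarrow> (\<integral>x. g (of_real x) \<partial>lborel)"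
  proof (rule integral_dominated_convergence[where w="\<lambda>x. norm (g (of_real x))"])
    show "AE x in lborel. (\<lambda>n. indicator {-real n..real n} x *\<^sub>R g (of_real x)) \<longlonglongrightarrow> g (of_real x)"
    proof (rule AE_I2)
      fix x :: real
      obtain N :: nat where "\<bar>x\<bar> \<le> real N" using real_arch_simple by blast
      then have "eventually (\<lambda>n. indicator {-real n..real n} x *\<^sub>R g (of_real x) = g (of_real x)) sequentially"
        by (intro eventually_sequentiallyI[of N]) (auto simp: indicator_def)
      then show "(\<lambda>n. indicator {-real n..real n} x *\<^sub>R g (of_real x)) \<longlonglongrightarrow> g (of_real x)"
        by (rule tendsto_eventually)
    qed
  qed (use meas int in \<open>auto simp: indicator_def\<close>)
  have "?I n = integral {-real n..real n} (\<lambda>x. g (of_real x))" for n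
    using set_borel_integral_eq_integral(2)[of "{-real n..real n}" "\<lambda>x. g (of_real x)"]
      integrable_mult_indicator[OF _ int, of "{-real n..real n}"]
    by (simp add: set_lebesgue_integral_def set_integrable_def)
  then have "eventually (\<lambda>n. norm (?I n) \<le> C / (1 + (real n)\<^sup>2) * real n * pi) sequentially"
    using arc by (intro eventually_sequentiallyI[of 1]) auto
  moreover have "(\<lambda>n. C / (1 + (real n)\<^sup>2) * real n * pi) \<longlonglongrightarrow> 0" by real_asymp
  ultimately have "?I \<longlonglongrightarrow> 0" by (rule Lim_null_comparison)
  with lim1 show ?thesis by (rule LIMSEQ_unique)
qed

text \<open>
  The boundary point \<open>0\<close> is exempt from continuity because the multipliers \<open>exp (\<i> a / z)\<close> have an
  essential singularity there; shifting the line of integration avoids it.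
\<close>

lemma lower_half_plane_boundary_integral_eq_0:
  fixes g :: "complex \<Rightarrow> complex"
  assumes holo: "g holomorphic_on {z. Im z < 0}"
    and bound: "\<And>z. Im z < 0 \<Longrightarrow> norm (g z) \<le> C / (1 + (norm z)\<^sup>2)"
    and cont: "\<And>x::real. x \<noteq> 0 \<Longrightarrow> isCont g (of_real x)"
    and meas: "(\<lambda>x::real. g (of_real x)) \<in> borel_measurable borel"
  shows "(\<integral>x. g (of_real x) \<partial>lborel) = 0"
proof -
  \<comment> \<open>Subtracting \<open>d n\<close> pushes the line strictly below the axis, so the
    translate of \<open>g\<close> is holomorphic up to height \<open>Im (d n) > 0\<close> and the
    preceding lemma applies.\<close>
  define d where "d n = \<i> * of_real (inverse (real (Suc n)))" for n
  have d: "Im (d n) > 0" "Re (d n) = 0" for n by (simp_all add: d_def)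
  have C: "C \<ge> 0"
    by (rule ccontr)
      (use order_trans[OF norm_ge_zero bound[of "- \<i>"]] in \<open>simp add: field_simps\<close>)
  \<comment> \<open>Moving down from the closed lower half-plane only increases the modulus, so the
    decay bound holds for all translates with the same constant and serves as dominating function
    below.\<close>
  have nrm: "norm z \<le> norm (z - d n)" if "Im z \<le> 0" for z n
    unfolding cmod_def using that d[of n] by (intro real_sqrt_le_mono add_mono) (auto simp: abs_le_square_iff[symmetric])
  have bd: "norm (g (z - d n)) \<le> C / (1 + (norm z)\<^sup>2)" if "Im z \<le> 0" for z n
  proof -
    have "norm (g (z - d n)) \<le> C / (1 + (norm (z - d n))\<^sup>2)"
      using that d[of n] by (intro bound) simp
    also have "\<dots> \<le> C / (1 + (norm z)\<^sup>2)"
      using C nrm[OF that] by (intro divide_left_mono add_left_mono power_mono mult_pos_pos add_pos_nonneg) auto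
    finally show ?thesis .
  qed
  have z: "(\<integral>x. g (of_real x - d n) \<partial>lborel) = 0" for n
  proof (rule lower_half_plane_integral_eq_0[where g="\<lambda>z. g (z - d n)"])
    show "(\<lambda>z. g (z - d n)) holomorphic_on {z. Im z < Im (d n)}"
      by (rule holomorphic_on_compose_gen[OF _ holo, unfolded o_def, of "\<lambda>z. z - d n"])
        (auto intro!: holomorphic_intros)
  qed (use d bd in auto)
  have "(\<lambda>n. \<integral>x. g (of_real x - d n) \<partial>lborel) \<longlonglongrightarrow> (\<integral>x. g (of_real x) \<partial>lborel)"
  proof (rule integral_dominated_convergence[where w="\<lambda>x. C * inverse (1 + x\<^sup>2)"])
    have dl: "d \<longlonglongrightarrow> 0" unfolding d_def
      by (rule tendsto_eq_intros tendsto_of_real LIMSEQ_inverse_real_of_nat | simp)+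
    have ae: "AE x::real in lborel. x \<noteq> 0"
      using AE_lborel_singleton[of "0::real"] by simp
    then show "AE x in lborel. (\<lambda>n. g (of_real x - d n)) \<longlonglongrightarrow> g (of_real x)"
    proof eventually_elim
      fix x :: real assume "x \<noteq> 0"
      show "(\<lambda>n. g (of_real x - d n)) \<longlonglongrightarrow> g (of_real x)"
        by (rule isCont_tendsto_compose[OF cont[OF \<open>x \<noteq> 0\<close>]])
          (use tendsto_diff[OF tendsto_const dl] in simp)
    qed
    show "(\<lambda>x::real. g (of_real x - d n)) \<in> borel_measurable lborel" for n
    proof -
      have "continuous_on UNIV (\<lambda>x::real. g (of_real x - d n))"
        by (rule continuous_on_compose2[OF holomorphic_on_imp_continuous_on[OF holo]])
          (use d in \<open>auto intro!: continuous_intros\<close>)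
      then show ?thesis by (simp add: borel_measurable_continuous_onI)
    qed
    show "AE x in lborel. norm (g (of_real x - d n)) \<le> C * inverse (1 + x\<^sup>2)" for n
      using bd[of "of_real _" n] by (auto simp: divide_inverse)
  qed (use meas integrable_lborel_inverse_1_plus_square in auto)
  then have "(\<lambda>n. 0::complex) \<longlonglongrightarrow> (\<integral>x. g (of_real x) \<partial>lborel)" unfolding z .
  then show ?thesis by (rule LIMSEQ_unique) simp
qed

section \<open>Integration against complex measures given by a density\<close>

lemma jordan_pos_cong:
  assumes "\<And>A. A \<in> sets borel \<Longrightarrow> \<nu> A = \<nu>' A"
  shows "jordan_pos \<nu> = jordan_pos \<nu>'"
  unfolding jordan_pos_def using assms by (intro arg_cong[where f="measure_of _ _"] ext SUP_cong) auto

text \<open>The density of the positive part is \<open>ennreal (g x)\<close>, and the coercion cuts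
  off negative values, so it equals \<open>max 0 (g x)\<close>.\<close>

lemma integral_jordan_pos:
  fixes g :: "'a::topological_space \<Rightarrow> real" and h :: "'a \<Rightarrow> complex"
  assumes M: "sets M = sets borel" and g: "integrable M g"
    and \<nu>: "\<And>A. A \<in> sets borel \<Longrightarrow> \<nu> A = (\<integral>x\<in>A. g x \<partial>M)"
    and h: "h \<in> borel_measurable borel"
  shows "integral\<^sup>L (jordan_pos \<nu>) h = (\<integral>x. max 0 (g x) *\<^sub>R h x \<partial>M)"
proof -
  have hM: "h \<in> borel_measurable M" using h measurable_cong_sets[OF M refl] by blast
  have "jordan_pos \<nu> = density M (\<lambda>x. ennreal (g x))"
    unfolding jordan_pos_density[OF M g, symmetric] by (rule jordan_pos_cong) (rule \<nu>)
  also have "\<dots> = density M (\<lambda>x. ennreal (max 0 (g x)))"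
    by (rule arg_cong[where f="density M"]) (auto simp: max_def ennreal_neg)
  finally show ?thesis
    using hM g by (simp add: integral_density)
qed

text \<open>The four Jordan parts have as densities the positive and negative parts of
  \<open>Re f\<close> and \<open>Im f\<close>, which recombine pointwise to \<open>f\<close>. The
  reference measure \<open>M\<close> is left general so that the result covers both Lebesgue measure
  on the line and its image on the hyperbola.\<close>

lemma complex_integral_density:
  fixes f h :: "'a::topological_space \<Rightarrow> complex"
  assumes M: "sets M = sets borel" and f: "integrable M f"
    and \<nu>: "\<And>A. A \<in> sets borel \<Longrightarrow> \<nu> A = (\<integral>x\<in>A. f x \<partial>M)"
    and h: "h \<in> borel_measurable borel" and bound: "\<And>x. norm (h x) \<le> B"
  shows "complex_integral \<nu> h = (\<integral>x. f x * h x \<partial>M)"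
proof -
  have hM: "h \<in> borel_measurable M" using h measurable_cong_sets[OF M refl] by blast
  have set_int: "integrable M (\<lambda>x. indicator A x *\<^sub>R f x)" if "A \<in> sets borel" for A
    using that M f by (intro integrable_mult_indicator) auto
  have re: "Re (\<nu> A) = (\<integral>x\<in>A. Re (f x) \<partial>M)" and im: "Im (\<nu> A) = (\<integral>x\<in>A. Im (f x) \<partial>M)"
    if "A \<in> sets borel" for A
    using integral_Re[OF set_int[OF that]] integral_Im[OF set_int[OF that]]
    by (simp_all add: \<nu>[OF that] set_lebesgue_integral_def)
  have fre: "integrable M (\<lambda>x. Re (f x))" and fim: "integrable M (\<lambda>x. Im (f x))"
    using f by auto
  have int: "integrable M (\<lambda>x. max 0 (g x) *\<^sub>R h x)" if "integrable M g" for g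
  proof (rule Bochner_Integration.integrable_bound[OF integrable_mult_left])
    show "integrable M g" by fact
    show "AE x in M. norm (max 0 (g x) *\<^sub>R h x) \<le> norm (g x * B)"
    proof (rule AE_I2)
      fix x
      have "0 \<le> B" using order_trans[OF norm_ge_zero bound[of x]] .
      then show "norm (max 0 (g x) *\<^sub>R h x) \<le> norm (g x * B)"
        using bound[of x] by (auto simp: abs_mult intro!: mult_mono)
    qed
  qed (use that hM in measurable)
  have "complex_integral \<nu> h =
      ((\<integral>x. max 0 (Re (f x)) *\<^sub>R h x \<partial>M) - (\<integral>x. max 0 (- Re (f x)) *\<^sub>R h x \<partial>M))
      + \<i> * ((\<integral>x. max 0 (Im (f x)) *\<^sub>R h x \<partial>M) - (\<integral>x. max 0 (- Im (f x)) *\<^sub>R h x \<partial>M))"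
    unfolding complex_integral_def
    using integral_jordan_pos[OF M fre re h] integral_jordan_pos[OF M fim im h]
      integral_jordan_pos[OF M integrable_minus[OF fre] _ h, of "\<lambda>A. - Re (\<nu> A)"]
      integral_jordan_pos[OF M integrable_minus[OF fim] _ h, of "\<lambda>A. - Im (\<nu> A)"]
    by (simp add: re im set_lebesgue_integral_def)
  also have "\<dots> = (\<integral>x. (max 0 (Re (f x)) *\<^sub>R h x - max 0 (- Re (f x)) *\<^sub>R h x)
      + \<i> * (max 0 (Im (f x)) *\<^sub>R h x - max 0 (- Im (f x)) *\<^sub>R h x) \<partial>M)"
    using int[OF fre] int[OF fim] int[OF integrable_minus[OF fre]] int[OF integrable_minus[OF fim]]
    by simp
  also have "\<dots> = (\<integral>x. f x * h x \<partial>M)"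
    by (rule Bochner_Integration.integral_cong)
      (auto simp: max_def complex_eq_iff algebra_simps)
  finally show ?thesis .
qed

section \<open>Measures on the hyperbola with a density on the line\<close>

definition hyperbola_point :: "real \<Rightarrow> real \<Rightarrow> real \<times> real" where
  "hyperbola_point m t = (t, - (m\<^sup>2 / (4 * pi\<^sup>2 * t)))"

lemma hyperbola_point_measurable [measurable]: "hyperbola_point m \<in> borel_measurable borel"
  unfolding hyperbola_point_def[abs_def] by (intro borel_measurable_Pair) measurable

lemma hyperbola_point_in_Gamma: "t \<noteq> 0 \<Longrightarrow> hyperbola_point m t \<in> Gamma m"
  by (simp add: hyperbola_point_def Gamma_def)

text \<open>The push-forward of \<open>f t dt\<close> under the parametrisation. The value 0 off the
  Borel sets is the normalisation that \<open>complex_measure\<close> demands.\<close>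

definition hyperbola_measure :: "real \<Rightarrow> (real \<Rightarrow> complex) \<Rightarrow> (real \<times> real) set \<Rightarrow> complex" where
  "hyperbola_measure m f A =
     (if A \<in> sets borel then \<integral>t\<in>hyperbola_point m -` A. f t \<partial>lborel else 0)"

lemma hyperbola_point_vimage: "A \<in> sets borel \<Longrightarrow> hyperbola_point m -` A \<in> sets borel"
  using measurable_sets[OF hyperbola_point_measurable, of A m] by simp

text \<open>The first coordinate inverts the parametrisation, so the measure has density
  \<open>f (fst x)\<close> with respect to the image of Lebesgue measure.\<close>

lemma complex_integral_hyperbola_measure:
  assumes f: "integrable lborel f" and h: "h \<in> borel_measurable borel" "\<And>x. norm (h x) \<le> B"
  shows "complex_integral (hyperbola_measure m f) h = (\<integral>t. f t * h (hyperbola_point m t) \<partial>lborel)"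
proof -
  let ?M = "distr lborel borel (hyperbola_point m)"
  have fm [measurable]: "f \<in> borel_measurable borel" using f by simp
  have [measurable]: "h \<in> borel_measurable borel" by fact
  have [measurable]: "(\<lambda>x::real \<times> real. f (fst x)) \<in> borel_measurable borel"
    by (rule measurable_compose[OF _ fm]) (simp add: borel_prod[symmetric])
  have [simp]: "fst (hyperbola_point m t) = t" for t by (simp add: hyperbola_point_def)
  have "complex_integral (hyperbola_measure m f) h = (\<integral>x. f (fst x) * h x \<partial>?M)"
  proof (rule complex_integral_density)
    show "integrable ?M (\<lambda>x. f (fst x))"
      using f by (subst integrable_distr_eq) auto
    show "hyperbola_measure m f A = (\<integral>x\<in>A. f (fst x) \<partial>?M)" if "A \<in> sets borel" for A
      using that unfolding hyperbola_measure_def set_lebesgue_integral_def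
      by (subst integral_distr) (auto simp: indicator_def vimage_def)
  qed (use h in auto)
  also have "\<dots> = (\<integral>t. f t * h (hyperbola_point m t) \<partial>lborel)"
    by (subst integral_distr) auto
  finally show ?thesis .
qed

lemma compression_hyperbola_measure:
  assumes "A \<in> sets borel"
  shows "compression (hyperbola_measure m f) A = (\<integral>t\<in>A. f t \<partial>lborel)"
proof -
  have "A \<times> UNIV \<in> sets (borel :: (real \<times> real) measure)"
    unfolding borel_prod[symmetric] using assms by (intro pair_measureI) auto
  moreover have "hyperbola_point m -` (A \<times> UNIV) = A" by (auto simp: hyperbola_point_def)
  ultimately show ?thesis by (simp add: compression_def hyperbola_measure_def)
qed

lemma complex_integral_compression_hyperbola_measure:
  assumes "integrable lborel f" "h \<in> borel_measurable borel" "\<And>x. norm (h x) \<le> B"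
  shows "complex_integral (compression (hyperbola_measure m f)) h = (\<integral>t. f t * h t \<partial>lborel)"
  by (rule complex_integral_density) (use assms compression_hyperbola_measure in auto)

text \<open>Dominated convergence along the finite partial unions, with dominating function
  \<open>norm (f x)\<close>.\<close>

lemma sums_set_integral:
  fixes f :: "'a \<Rightarrow> complex"
  assumes f: "integrable M f" and A: "range A \<subseteq> sets M" and disj: "disjoint_family A"
  shows "(\<lambda>i. \<integral>x\<in>A i. f x \<partial>M) sums (\<integral>x\<in>(\<Union>i. A i). f x \<partial>M)"
proof -
  have int: "integrable M (\<lambda>x. indicator B x *\<^sub>R f x)" if "B \<in> sets M" for B
    using that f by (rule integrable_mult_indicator)
  have Ui: "(\<Union>i<n. A i) \<in> sets M" for n using A by auto
  have "(\<lambda>n. \<integral>x. indicator (\<Union>i<n. A i) x *\<^sub>R f x \<partial>M)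
      \<longlonglongrightarrow> (\<integral>x. indicator (\<Union>i. A i) x *\<^sub>R f x \<partial>M)"
  proof (rule integral_dominated_convergence[where w="\<lambda>x. norm (f x)"])
    show "AE x in M. (\<lambda>n. indicator (\<Union>i<n. A i) x *\<^sub>R f x) \<longlonglongrightarrow> indicator (\<Union>i. A i) x *\<^sub>R f x"
      by (intro AE_I2 tendsto_scaleR tendsto_const LIMSEQ_indicator_UN)
    show "(\<lambda>x. indicator (\<Union>i. A i) x *\<^sub>R f x) \<in> borel_measurable M"
      using A int[of "\<Union>i. A i"] by (auto simp: image_subset_iff)
    show "(\<lambda>x. indicator (\<Union>i<n. A i) x *\<^sub>R f x) \<in> borel_measurable M" for n
      using int[OF Ui] by auto
  qed (use f in \<open>auto simp: indicator_def\<close>)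
  moreover have "(\<integral>x. indicator (\<Union>i<n. A i) x *\<^sub>R f x \<partial>M) = (\<Sum>i<n. \<integral>x. indicator (A i) x *\<^sub>R f x \<partial>M)" for n
  proof -
    have "indicator (\<Union>i<n. A i) x *\<^sub>R f x = (\<Sum>i<n. indicator (A i) x *\<^sub>R f x)" for x
      using disj by (subst indicator_UN_disjoint)
        (auto simp: scaleR_sum_left disjoint_family_on_def)
    then have "(\<integral>x. indicator (\<Union>i<n. A i) x *\<^sub>R f x \<partial>M)
        = (\<integral>x. (\<Sum>i<n. indicator (A i) x *\<^sub>R f x) \<partial>M)" by (simp only:)
    also have "\<dots> = (\<Sum>i<n. \<integral>x. indicator (A i) x *\<^sub>R f x \<partial>M)"
      using int A by (intro Bochner_Integration.integral_sum) auto
    finally show ?thesis .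
  qed
  ultimately show ?thesis
    by (simp add: sums_def set_lebesgue_integral_def)
qed

text \<open>Absolute continuity is checked on the compression, which is simply
  \<open>f t dt\<close>, and carried back to arc length by
  \<open>abs_cont_arc_length_iff\<close>.\<close>

lemma hyperbola_measure_AC0:
  assumes "m > 0" and f: "integrable lborel f" and zero: "(\<integral>t. f t \<partial>lborel) = 0"
  shows "hyperbola_measure m f \<in> AC0 m"
proof -
  have null: "(\<integral>t\<in>A. f t \<partial>lborel) = 0" if "A \<in> sets borel" "emeasure lborel A = 0" for A
  proof -
    have "AE t in lborel. t \<notin> A" using that by (intro AE_not_in) (auto simp: null_sets_def)
    then have "AE t in lborel. indicator A t *\<^sub>R f t = 0" by eventually_elim simp
    then show ?thesis unfolding set_lebesgue_integral_def by (rule integral_eq_zero_AE)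
  qed
  have cm: "complex_measure (hyperbola_measure m f)"
    unfolding complex_measure_def
  proof (intro conjI allI impI)
    fix A :: "nat \<Rightarrow> (real \<times> real) set"
    assume A: "range A \<subseteq> sets borel" "disjoint_family A"
    have "(\<lambda>i. \<integral>t\<in>hyperbola_point m -` A i. f t \<partial>lborel)
        sums (\<integral>t\<in>(\<Union>i. hyperbola_point m -` A i). f t \<partial>lborel)"
      using A by (intro sums_set_integral f)
        (auto intro!: hyperbola_point_vimage disjoint_family_on_vimageI)
    moreover have "A i \<in> sets borel" "(\<Union>i. A i) \<in> sets borel" for i using A(1) by auto
    ultimately show "(\<lambda>i. hyperbola_measure m f (A i)) sums hyperbola_measure m f (\<Union>i. A i)"
      by (simp add: hyperbola_measure_def vimage_UN)
  qed (simp add: hyperbola_measure_def)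
  have supp: "supported_on (hyperbola_measure m f) (Gamma m)"
    unfolding supported_on_def
  proof (intro ballI impI)
    fix A :: "(real \<times> real) set" assume A: "A \<in> sets borel" "A \<inter> Gamma m = {}"
    \<comment> \<open>Only \<open>t = 0\<close> can be mapped off the hyperbola: division by zero
      sends it to the origin. A single point is a null set, so no mass is lost there.\<close>
    have "hyperbola_point m -` A \<subseteq> {0}" using A(2) hyperbola_point_in_Gamma by blast
    then have "emeasure lborel (hyperbola_point m -` A) \<le> emeasure lborel {0::real}"
      by (rule emeasure_mono) simp
    then show "hyperbola_measure m f A = 0"
      using null[OF hyperbola_point_vimage[OF A(1)]] A(1) by (simp add: hyperbola_measure_def)
  qed
  have "abs_cont (compression (hyperbola_measure m f)) lborel"
    using null by (auto simp: abs_cont_def compression_hyperbola_measure)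
  then have "abs_cont (hyperbola_measure m f) (arc_length m)"
    using abs_cont_arc_length_iff[OF supp cm \<open>m > 0\<close>] by simp
  moreover have "hyperbola_measure m f UNIV = 0"
    using zero by (simp add: hyperbola_measure_def set_lebesgue_integral_def)
  ultimately show ?thesis using cm supp by (simp add: AC0_def)
qed

lemma fourier_hyperbola_measure:
  assumes "integrable lborel f"
  shows "fourier (hyperbola_measure m f) \<xi> =
    (\<integral>t. f t * exp (\<i> * of_real (pi * (t * fst \<xi> - m\<^sup>2 / (4 * pi\<^sup>2 * t) * snd \<xi>))) \<partial>lborel)"
proof -
  have "(\<lambda>x. exp (\<i> * of_real (pi * (x \<bullet> \<xi>)))) \<in> borel_measurable borel"
    by (intro borel_measurable_continuous_onI continuous_intros)
  moreover have "norm (exp (\<i> * of_real (pi * (x \<bullet> \<xi>)))) \<le> 1" for x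
    by (simp add: norm_exp_i_times)
  ultimately show ?thesis
    unfolding fourier_def
    by (subst complex_integral_hyperbola_measure[OF assms])
      (auto simp: hyperbola_point_def inner_prod_def algebra_simps)
qed

section \<open>Principal values and the Hilbert transform of test functions\<close>

lemma integrable_mult_bounded:
  fixes f h :: "'a \<Rightarrow> complex"
  assumes f: "integrable M f" and h: "h \<in> borel_measurable M" and bound: "\<And>x. norm (h x) \<le> C"
  shows "integrable M (\<lambda>x. f x * h x)"
proof (rule Bochner_Integration.integrable_bound)
  show "integrable M (\<lambda>x. of_real C * f x)" using f by simp
  show "AE x in M. norm (f x * h x) \<le> norm (of_real C * f x)"
  proof (rule AE_I2)
    fix x
    have "norm (f x * h x) \<le> norm (f x) * C" unfolding norm_mult by (intro mult_left_mono bound) simp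
    also have "\<dots> \<le> norm (f x) * \<bar>C\<bar>" by (intro mult_left_mono) auto
    finally show "norm (f x * h x) \<le> norm (of_real C * f x)" by (simp add: norm_mult mult.commute)
  qed
qed (use f h in measurable)

text \<open>The kernel is the real part of \<open>1 / (s - \<i> * \<epsilon>)\<close>. The bound
  blows up as \<epsilon> tends to 0; it serves only to make the integrals exist for each fixed
  \<epsilon>.\<close>

lemma abs_conjugate_kernel_le:
  fixes s \<epsilon> :: real
  assumes "\<epsilon> > 0"
  shows "\<bar>s / (s\<^sup>2 + \<epsilon>\<^sup>2)\<bar> \<le> 1 / \<epsilon>"
proof -
  have "2 * (\<bar>s\<bar> * \<epsilon>) \<le> s\<^sup>2 + \<epsilon>\<^sup>2"
    using sum_squares_bound[of "\<bar>s\<bar>" \<epsilon>] by simp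
  moreover have "0 \<le> \<bar>s\<bar> * \<epsilon>" using assms by simp
  ultimately have "\<bar>s\<bar> * \<epsilon> \<le> s\<^sup>2 + \<epsilon>\<^sup>2" by linarith
  then show ?thesis using assms by (simp add: divide_simps add_nonneg_pos)
qed

text \<open>What the Hilbert transform argument takes from a test function: the Lipschitz bound
  tames the singularity of the kernel, integrability controls the part far from it, and the sup
  bound controls the Poisson integral.\<close>

locale lipschitz_L1 =
  fixes \<phi> :: "real \<Rightarrow> complex" and L B :: real
  assumes lipschitz: "norm (\<phi> x - \<phi> y) \<le> L * \<bar>x - y\<bar>"
    and bounded: "norm (\<phi> x) \<le> B"
    and integrable: "integrable lborel \<phi>"

lemma test_function_lipschitz_L1:
  assumes "test_function \<phi>"
  obtains L B where "lipschitz_L1 \<phi> L B"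
proof -
  let ?D = "\<lambda>x. vector_derivative \<phi> (at x)"
  let ?K = "closure {x. \<phi> x \<noteq> 0}"
  have *: "((\<lambda>\<psi> x. vector_derivative \<psi> (at x)) ^^ n) \<phi> differentiable_on UNIV" for n
    using assms by (auto simp: test_function_def)
  have diff: "\<phi> differentiable_on UNIV" using *[of 0] by simp
  have "?D differentiable_on UNIV" using *[of 1] by simp
  then have contD: "continuous_on UNIV ?D" by (rule differentiable_imp_continuous_on)
  have cont: "continuous_on UNIV \<phi>" using diff by (rule differentiable_imp_continuous_on)
  have K: "compact ?K" using assms by (simp add: test_function_def)
  have zero: "\<phi> x = 0" if "x \<notin> ?K" for x
    using that closure_subset[of "{x. \<phi> x \<noteq> 0}"] by auto
  have der: "(\<phi> has_vector_derivative ?D x) (at x)" for x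
    using diff by (simp add: differentiable_on_def vector_derivative_works)
  \<comment> \<open>Off the closed support the function vanishes on a neighbourhood, hence so does
    its derivative; a bound for the derivative on the compact support is then global and yields the
    Lipschitz constant.\<close>
  have D0: "?D x = 0" if "x \<notin> ?K" for x
  proof -
    have "((\<lambda>_. 0) has_vector_derivative 0) (at x)" by simp
    then have "(\<phi> has_vector_derivative 0) (at x)"
    proof (rule has_vector_derivative_transform_within_open)
      show "open (- ?K)" by (rule open_Compl[OF closed_closure])
      show "x \<in> - ?K" using that by (simp only: Compl_iff not_False_eq_True)
      show "0 = \<phi> y" if "y \<in> - ?K" for y using zero[of y] that by (simp only: Compl_iff not_False_eq_True)
    qed
    then show ?thesis by (rule vector_derivative_at)
  qed
  obtain L where L: "\<And>x. x \<in> ?K \<Longrightarrow> norm (?D x) \<le> L" "L > 0"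
    using compact_imp_bounded[OF compact_continuous_image[OF continuous_on_subset[OF contD] K]]
    by (auto simp: bounded_pos)
  obtain B where B: "\<And>x. x \<in> ?K \<Longrightarrow> norm (\<phi> x) \<le> B" "B > 0"
    using compact_imp_bounded[OF compact_continuous_image[OF continuous_on_subset[OF cont] K]]
    by (auto simp: bounded_pos)
  have "lipschitz_L1 \<phi> L B"
  proof
    fix x y
    have "norm (\<phi> x - \<phi> y) \<le> L * norm (x - y)"
    proof (rule differentiable_bound[of UNIV])
      show "(\<phi> has_derivative (\<lambda>h. h *\<^sub>R ?D z)) (at z within UNIV)" for z
        using der[of z] by (simp add: has_vector_derivative_def)
      have "norm (?D z) \<le> L" for z
      proof (cases "z \<in> ?K")
        case False then show ?thesis using D0[OF False] L(2) by simp
      qed (rule L(1))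
      then show "onorm (\<lambda>h. h *\<^sub>R ?D z) \<le> L" for z
        by (intro onorm_le) (simp add: mult.commute[of L] mult_left_mono)
    qed auto
    then show "norm (\<phi> x - \<phi> y) \<le> L * \<bar>x - y\<bar>" by simp
    show "norm (\<phi> x) \<le> B"
    proof (cases "x \<in> ?K")
      case False then show ?thesis using zero[OF False] B(2) by simp
    qed (rule B(1))
    have "integrable lborel (\<lambda>x. indicator ?K x *\<^sub>R \<phi> x)"
      by (rule borel_integrable_compact[OF K continuous_on_subset[OF cont]]) simp
    moreover have "(\<lambda>x. indicator ?K x *\<^sub>R \<phi> x) = \<phi>"
    proof
      fix x show "indicator ?K x *\<^sub>R \<phi> x = \<phi> x"
        by (cases "x \<in> ?K") (simp_all only: indicator_simps zero scaleR_one scaleR_zero_right not_False_eq_True)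
    qed
    ultimately show "integrable lborel \<phi>" by (simp only:)
  qed
  then show thesis by (rule that)
qed

context lipschitz_L1
begin

lemma measurable [measurable]: "\<phi> \<in> borel_measurable borel"
  using integrable by simp

lemma integrable_shifts: "integrable lborel (\<lambda>s. \<phi> (x - s))" "integrable lborel (\<lambda>s. \<phi> (x + s))"
  using lborel_integrable_real_affine[OF integrable, of "-1" x]
    lborel_integrable_real_affine[OF integrable, of 1 x] by simp_all

text \<open>Pairing \<open>s\<close> with \<open>- s\<close> in the principal value of
  \<open>\<phi> (x - s) / s\<close> cancels the singularity, because the Lipschitz bound keeps this
  quotient bounded near 0. Integrating over the whole line counts every pair twice, whence the
  factor 1/2 in \<open>pv\<close>.\<close>

definition diffquot :: "real \<Rightarrow> real \<Rightarrow> complex" where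
  "diffquot x s = (\<phi> (x - s) - \<phi> (x + s)) / of_real s"

definition dominator :: "real \<Rightarrow> real \<Rightarrow> real" where
  "dominator x s = 2 * L * indicator {-1..1} s + norm (\<phi> (x - s)) + norm (\<phi> (x + s))"

definition pv :: "real \<Rightarrow> complex" where
  "pv x = (1/2) * (\<integral>s. diffquot x s \<partial>lborel)"

text \<open>Half the integral of \<open>dominator x\<close>, which is the same for every
  \<open>x\<close>.\<close>

definition pv_bound :: real where
  "pv_bound = 2 * L + (\<integral>s. norm (\<phi> s) \<partial>lborel)"

lemma diffquot_measurable [measurable]: "diffquot x \<in> borel_measurable borel"
  unfolding diffquot_def[abs_def] by measurable

lemma L_nonneg: "0 \<le> L"
  using order_trans[OF norm_ge_zero lipschitz[of 1 0]] by simp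

lemma B_nonneg: "0 \<le> B"
  using order_trans[OF norm_ge_zero bounded[of 0]] .

lemma norm_diffquot_le: "norm (diffquot x s) \<le> dominator x s"
proof (cases "\<bar>s\<bar> \<le> 1")
  case True
  have "norm (\<phi> (x - s) - \<phi> (x + s)) \<le> L * \<bar>(x - s) - (x + s)\<bar>" by (rule lipschitz)
  also have "\<dots> = 2 * L * \<bar>s\<bar>" by (simp add: abs_mult)
  finally have "norm (diffquot x s) \<le> 2 * L"
    using L_nonneg by (cases "s = 0") (auto simp: diffquot_def norm_divide field_simps)
  moreover have "s \<in> {-1..1}" using True by auto
  ultimately show ?thesis by (simp add: dominator_def add_increasing2)
next
  case False
  have "norm (diffquot x s) = norm (\<phi> (x - s) - \<phi> (x + s)) / \<bar>s\<bar>" by (simp add: diffquot_def norm_divide)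
  also have "\<dots> \<le> norm (\<phi> (x - s) - \<phi> (x + s)) / 1"
    using False by (intro divide_left_mono) auto
  also have "\<dots> \<le> norm (\<phi> (x - s)) + norm (\<phi> (x + s))" by (simp add: norm_triangle_ineq4)
  finally show ?thesis using L_nonneg by (simp add: dominator_def indicator_def)
qed

lemma integrable_dominator: "integrable lborel (dominator x)"
  unfolding dominator_def[abs_def] using integrable_shifts by auto

lemma integral_dominator: "(\<integral>s. dominator x s \<partial>lborel) = 2 * pv_bound"
proof -
  have "(\<integral>s. norm (\<phi> (x - s)) \<partial>lborel) = (\<integral>s. norm (\<phi> s) \<partial>lborel)"
    "(\<integral>s. norm (\<phi> (x + s)) \<partial>lborel) = (\<integral>s. norm (\<phi> s) \<partial>lborel)"
    using lborel_integral_real_affine[of "-1" "\<lambda>s. norm (\<phi> s)" x]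
      lborel_integral_real_affine[of 1 "\<lambda>s. norm (\<phi> s)" x] by simp_all
  then show ?thesis
    unfolding dominator_def pv_bound_def using integrable_shifts by (subst Bochner_Integration.integral_add | simp)+
qed

text \<open>The integral is averaged with its image under the reflection of \<open>s\<close>, where
  oddness of \<open>k\<close> supplies the minus sign. The singular kernel is thereby replaced by
  the harmless weight \<open>s * k s\<close>.\<close>

lemma integral_symmetrize:
  fixes k :: "real \<Rightarrow> real"
  assumes [measurable]: "k \<in> borel_measurable borel"
    and odd: "\<And>s. k (-s) = - k s" and bound: "\<And>s. \<bar>k s\<bar> \<le> C"
  shows "(\<integral>s. \<phi> (x - s) * of_real (k s) \<partial>lborel) =
    (1/2) * (\<integral>s. diffquot x s * of_real (s * k s) \<partial>lborel)"
proof -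
  have int: "integrable lborel (\<lambda>s. \<phi> (x - s) * of_real (k s))"
     "integrable lborel (\<lambda>s. \<phi> (x + s) * of_real (k s))"
    by (rule integrable_mult_bounded[OF _ _, where C=C]; use integrable_shifts bound in simp)+
  have "k 0 = 0" using odd[of 0] by simp
  have "(\<integral>s. \<phi> (x - s) * of_real (k s) \<partial>lborel) = - (\<integral>s. \<phi> (x + s) * of_real (k s) \<partial>lborel)"
    using lborel_integral_real_affine[of "-1" "\<lambda>s. \<phi> (x - s) * of_real (k s)" 0] by (simp add: odd)
  then have "(\<integral>s. \<phi> (x - s) * of_real (k s) \<partial>lborel) =
      (1/2) * ((\<integral>s. \<phi> (x - s) * of_real (k s) \<partial>lborel) - (\<integral>s. \<phi> (x + s) * of_real (k s) \<partial>lborel))"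
    by simp
  also have "\<dots> = (1/2) * (\<integral>s. \<phi> (x - s) * of_real (k s) - \<phi> (x + s) * of_real (k s) \<partial>lborel)"
    using int by simp
  also have "(\<integral>s. \<phi> (x - s) * of_real (k s) - \<phi> (x + s) * of_real (k s) \<partial>lborel)
      = (\<integral>s. diffquot x s * of_real (s * k s) \<partial>lborel)"
    by (rule Bochner_Integration.integral_cong)
      (use \<open>k 0 = 0\<close> in \<open>auto simp: diffquot_def divide_simps algebra_simps\<close>)
  finally show ?thesis .
qed

text \<open>All odd kernels that approximate \<open>1 / s\<close> in this sense produce the same
  principal value, by dominated convergence after symmetrization. This is used for the sharp
  truncations in \<open>hilbert\<close> and for the smooth kernels in \<open>Plemelj\<close>. The
  constants \<open>C n\<close> may grow; they give integrability only.\<close>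

lemma tendsto_pv:
  fixes k :: "nat \<Rightarrow> real \<Rightarrow> real"
  assumes [measurable]: "\<And>n. k n \<in> borel_measurable borel"
    and odd: "\<And>n s. k n (-s) = - k n s" and bound: "\<And>n s. \<bar>k n s\<bar> \<le> C n"
    and le: "\<And>n s. \<bar>s * k n s\<bar> \<le> 1"
    and lim: "\<And>s. s \<noteq> 0 \<Longrightarrow> (\<lambda>n. s * k n s) \<longlonglongrightarrow> 1"
  shows "(\<lambda>n. \<integral>s. \<phi> (x - s) * of_real (k n s) \<partial>lborel) \<longlonglongrightarrow> pv x"
    and "norm (\<integral>s. \<phi> (x - s) * of_real (k n s) \<partial>lborel) \<le> pv_bound"
proof -
  have dom: "norm (diffquot x s * of_real (s * k n s)) \<le> dominator x s" for n s
  proof -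
    have "norm (diffquot x s * of_real (s * k n s)) = norm (diffquot x s) * \<bar>s * k n s\<bar>"
      by (simp only: norm_mult norm_of_real)
    also have "\<dots> \<le> norm (diffquot x s) * 1"
      by (intro mult_left_mono le) simp
    finally show ?thesis using norm_diffquot_le[of x s] by simp
  qed
  have "(\<lambda>n. \<integral>s. diffquot x s * of_real (s * k n s) \<partial>lborel) \<longlonglongrightarrow> (\<integral>s. diffquot x s \<partial>lborel)"
  proof (rule integral_dominated_convergence[OF _ _ integrable_dominator[of x]])
    show "AE s in lborel. (\<lambda>n. diffquot x s * of_real (s * k n s)) \<longlonglongrightarrow> diffquot x s"
    proof (rule AE_I2)
      fix s
      show "(\<lambda>n. diffquot x s * of_real (s * k n s)) \<longlonglongrightarrow> diffquot x s"
      proof (cases "s = 0")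
        case True then show ?thesis by (simp add: diffquot_def)
      next
        case False
        show ?thesis
          using tendsto_mult[OF tendsto_const tendsto_of_real[OF lim[OF False]], of "diffquot x s"] by simp
      qed
    qed
    show "AE s in lborel. norm (diffquot x s * of_real (s * k n s)) \<le> dominator x s" for n
      using dom by simp
  qed measurable
  then show "(\<lambda>n. \<integral>s. \<phi> (x - s) * of_real (k n s) \<partial>lborel) \<longlonglongrightarrow> pv x"
    unfolding integral_symmetrize[OF assms(1) odd bound] pv_def by (intro tendsto_intros)
  have "norm (\<integral>s. diffquot x s * of_real (s * k n s) \<partial>lborel) \<le> (\<integral>s. dominator x s \<partial>lborel)"
  proof (rule Bochner_Integration.integral_norm_bound_integral)
    show "integrable lborel (\<lambda>s. diffquot x s * of_real (s * k n s))"
      by (rule Bochner_Integration.integrable_bound[OF integrable_dominator[of x]], measurable)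
        (rule AE_I2, rule order_trans[OF dom], simp)
  qed (use dom integrable_dominator in auto)
  then show "norm (\<integral>s. \<phi> (x - s) * of_real (k n s) \<partial>lborel) \<le> pv_bound"
    unfolding integral_symmetrize[OF assms(1) odd bound] integral_dominator
    by (simp add: norm_mult)
qed

text \<open>The sharp truncations of \<open>1 / s\<close> are an instance of
  \<open>tendsto_pv\<close>, the one-sided limit being tested along sequences. In particular the
  limit in \<open>hilbert\<close> exists.\<close>

lemma hilbert_eq_pv: "hilbert \<phi> x = pv x / of_real pi"
proof -
  let ?k = "\<lambda>\<epsilon> s::real. if \<epsilon> < \<bar>s\<bar> then 1 / s else 0"
  let ?T = "\<lambda>\<epsilon>. LINT t:{t. \<epsilon> < \<bar>x - t\<bar>}|lborel. \<phi> t / of_real (x - t)"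
  have T: "?T \<epsilon> = (\<integral>s. \<phi> (x - s) * of_real (?k \<epsilon> s) \<partial>lborel)" for \<epsilon>
    unfolding set_lebesgue_integral_def
    by (subst lborel_integral_real_affine[of "-1" _ x])
      (auto intro!: Bochner_Integration.integral_cong)
  have "(?T \<longlongrightarrow> pv x) (at_right 0)"
    unfolding T
  proof (rule tendsto_at_right_sequentially[of 0 1])
    fix S :: "nat \<Rightarrow> real" assume S: "\<And>n. 0 < S n" "S \<longlonglongrightarrow> 0"
    show "(\<lambda>n. \<integral>s. \<phi> (x - s) * of_real (?k (S n) s) \<partial>lborel) \<longlonglongrightarrow> pv x"
    proof (rule tendsto_pv(1))
      show "\<bar>?k (S n) s\<bar> \<le> 1 / S n" for n s
        using S(1)[of n] by (auto simp: abs_divide intro!: divide_left_mono mult_pos_pos)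
      show "(\<lambda>n. s * ?k (S n) s) \<longlonglongrightarrow> 1" if "s \<noteq> 0" for s
      proof (rule tendsto_eventually)
        have "eventually (\<lambda>n. S n < \<bar>s\<bar>) sequentially"
          using that by (intro order_tendstoD(2)[OF S(2)]) simp
        then show "eventually (\<lambda>n. s * ?k (S n) s = 1) sequentially"
          by eventually_elim (use that in simp)
      qed
    qed (auto)
  qed simp
  then have "((\<lambda>\<epsilon>. 1 / of_real pi * ?T \<epsilon>) \<longlongrightarrow> 1 / of_real pi * pv x) (at_right 0)"
    by (intro tendsto_intros)
  then show ?thesis
    unfolding hilbert_def by (subst tendsto_Lim[of "at_right 0"]) auto
qed

text \<open>The kernel \<open>1 / (s - \<i> * \<sigma> * \<epsilon>)\<close> splits into the
  conjugate Poisson kernel and \<open>\<i> * \<sigma>\<close> times the Poisson kernel. Substituting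
  \<open>s = \<epsilon> * u\<close> in the second moves \<epsilon> from the kernel into the argument
  of \<phi>, ready for dominated convergence.\<close>

lemma Cauchy_integral_eq:
  fixes \<epsilon> \<sigma> :: real
  assumes "\<epsilon> > 0" "\<bar>\<sigma>\<bar> = 1"
  shows "(\<integral>t. \<phi> t / (of_real (x - t) - \<i> * of_real (\<sigma> * \<epsilon>)) \<partial>lborel) =
    (\<integral>s. \<phi> (x - s) * of_real (s / (s\<^sup>2 + \<epsilon>\<^sup>2)) \<partial>lborel)
    + \<i> * of_real \<sigma> * (\<integral>u. \<phi> (x - \<epsilon> * u) * of_real (inverse (1 + u\<^sup>2)) \<partial>lborel)"
proof -
  have s2: "\<sigma> * \<sigma> = 1" using assms(2) using abs_mult_self_eq[of \<sigma>] by simp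
  have pos: "s\<^sup>2 + \<epsilon>\<^sup>2 > 0" for s using assms by (simp add: add_nonneg_pos)
  have int: "integrable lborel (\<lambda>s. \<phi> (x - s) * of_real (s / (s\<^sup>2 + \<epsilon>\<^sup>2)))"
      "integrable lborel (\<lambda>s. \<phi> (x - s) * of_real (\<epsilon> / (s\<^sup>2 + \<epsilon>\<^sup>2)))"
  proof -
    note e1 = abs_conjugate_kernel_le[OF \<open>\<epsilon> > 0\<close>]
    have e2: "\<bar>\<epsilon> / (s\<^sup>2 + \<epsilon>\<^sup>2)\<bar> \<le> 1 / \<epsilon>" for s
      using pos[of s] \<open>\<epsilon> > 0\<close> by (simp add: divide_simps power2_eq_square)
    show "integrable lborel (\<lambda>s. \<phi> (x - s) * of_real (s / (s\<^sup>2 + \<epsilon>\<^sup>2)))"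
      by (rule integrable_mult_bounded[OF integrable_shifts(1), where C="1/\<epsilon>"], measurable)
        (simp only: norm_of_real e1)
    show "integrable lborel (\<lambda>s. \<phi> (x - s) * of_real (\<epsilon> / (s\<^sup>2 + \<epsilon>\<^sup>2)))"
      by (rule integrable_mult_bounded[OF integrable_shifts(1), where C="1/\<epsilon>"], measurable)
        (simp only: norm_of_real e2)
  qed
  have "(\<integral>t. \<phi> t / (of_real (x - t) - \<i> * of_real (\<sigma> * \<epsilon>)) \<partial>lborel)
      = (\<integral>s. \<phi> (x - s) / (of_real s - \<i> * of_real (\<sigma> * \<epsilon>)) \<partial>lborel)"
    by (subst lborel_integral_real_affine[of "-1" _ x]) auto
  also have "\<dots> = (\<integral>s. \<phi> (x - s) * of_real (s / (s\<^sup>2 + \<epsilon>\<^sup>2))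
      + \<i> * of_real \<sigma> * (\<phi> (x - s) * of_real (\<epsilon> / (s\<^sup>2 + \<epsilon>\<^sup>2))) \<partial>lborel)"
  proof (rule Bochner_Integration.integral_cong)
    fix s
    have "(of_real s - \<i> * of_real (\<sigma> * \<epsilon>)) * (of_real s + \<i> * of_real (\<sigma> * \<epsilon>)) = complex_of_real (s\<^sup>2 + \<epsilon>\<^sup>2)"
      using s2 by (simp add: complex_eq_iff power2_eq_square algebra_simps) 
    moreover have "complex_of_real (s\<^sup>2 + \<epsilon>\<^sup>2) \<noteq> 0" using pos[of s] unfolding of_real_eq_0_iff by (rule less_imp_neq[THEN not_sym])
    moreover have "w / a = w * (b / c)" if "a * b = c" "c \<noteq> 0" for a b c w :: complex
      using that by (auto simp: field_simps)
    ultimately have "\<phi> (x - s) / (of_real s - \<i> * of_real (\<sigma> * \<epsilon>))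
        = \<phi> (x - s) * ((of_real s + \<i> * of_real (\<sigma> * \<epsilon>)) / complex_of_real (s\<^sup>2 + \<epsilon>\<^sup>2))"
      by blast
    also have "(of_real s + \<i> * of_real (\<sigma> * \<epsilon>)) / complex_of_real (s\<^sup>2 + \<epsilon>\<^sup>2)
        = of_real (s / (s\<^sup>2 + \<epsilon>\<^sup>2)) + \<i> * of_real \<sigma> * of_real (\<epsilon> / (s\<^sup>2 + \<epsilon>\<^sup>2))"
      by (simp add: add_divide_distrib)
    also have "w * (p + j * q) = w * p + j * (w * q)" for w p j q :: complex
      by (simp add: algebra_simps)
    finally show "\<phi> (x - s) / (of_real s - \<i> * of_real (\<sigma> * \<epsilon>)) = \<phi> (x - s) * of_real (s / (s\<^sup>2 + \<epsilon>\<^sup>2))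
      + \<i> * of_real \<sigma> * (\<phi> (x - s) * of_real (\<epsilon> / (s\<^sup>2 + \<epsilon>\<^sup>2)))" .
  qed simp
  also have "\<dots> = (\<integral>s. \<phi> (x - s) * of_real (s / (s\<^sup>2 + \<epsilon>\<^sup>2)) \<partial>lborel)
    + \<i> * of_real \<sigma> * (\<integral>s. \<phi> (x - s) * of_real (\<epsilon> / (s\<^sup>2 + \<epsilon>\<^sup>2)) \<partial>lborel)"
    by (subst Bochner_Integration.integral_add[OF int(1) integrable_mult_right[OF int(2)]])
      (simp only: integral_mult_right_zero)
  also have "(\<integral>s. \<phi> (x - s) * of_real (\<epsilon> / (s\<^sup>2 + \<epsilon>\<^sup>2)) \<partial>lborel)
      = (\<integral>u. \<epsilon> *\<^sub>R (\<phi> (x - \<epsilon> * u) * of_real (\<epsilon> / ((\<epsilon> * u)\<^sup>2 + \<epsilon>\<^sup>2))) \<partial>lborel)"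
    using \<open>\<epsilon> > 0\<close> lborel_integral_real_affine[of \<epsilon> "\<lambda>s. \<phi> (x - s) * of_real (\<epsilon> / (s\<^sup>2 + \<epsilon>\<^sup>2))" 0]
    by (simp only: integral_scaleR_right abs_of_pos add_0 less_imp_neq[symmetric] not_False_eq_True)
  also have "\<dots> = (\<integral>u. \<phi> (x - \<epsilon> * u) * of_real (inverse (1 + u\<^sup>2)) \<partial>lborel)"
  proof (rule Bochner_Integration.integral_cong)
    fix u
    have sc: "\<epsilon> *\<^sub>R (w * of_real y) = w * complex_of_real (\<epsilon> * y)" for w y
      by (simp add: scaleR_conv_of_real)
    have "\<epsilon> * (\<epsilon> / ((\<epsilon> * u)\<^sup>2 + \<epsilon>\<^sup>2)) = (\<epsilon> * \<epsilon>) / ((\<epsilon> * \<epsilon>) * (1 + u\<^sup>2))"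
      by (simp add: power2_eq_square algebra_simps)
    also have "\<dots> = inverse (1 + u\<^sup>2)" using \<open>\<epsilon> > 0\<close>
      unfolding inverse_eq_divide by (intro nonzero_divide_mult_cancel_left) simp
    finally have "\<epsilon> * (\<epsilon> / ((\<epsilon> * u)\<^sup>2 + \<epsilon>\<^sup>2)) = inverse (1 + u\<^sup>2)" .
    then show "\<epsilon> *\<^sub>R (\<phi> (x - \<epsilon> * u) * of_real (\<epsilon> / ((\<epsilon> * u)\<^sup>2 + \<epsilon>\<^sup>2))) = \<phi> (x - \<epsilon> * u) * of_real (inverse (1 + u\<^sup>2))"
      by (simp only: sc)
  qed simp
  finally show ?thesis .
qed

text \<open>The conjugate Poisson part tends to the principal value, and the Poisson part, of mass
  \<open>pi\<close>, concentrates at \<open>x\<close> and yields the jump term. The sign \<sigma>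
  tells from which side the line is approached. The bound is uniform in \<open>x\<close> and
  \<open>n\<close>, which permits integration against an integrable function.\<close>

lemma Plemelj:
  fixes \<epsilon> :: "nat \<Rightarrow> real"
  assumes \<epsilon>: "\<And>n. \<epsilon> n > 0" "\<epsilon> \<longlonglongrightarrow> 0" and \<sigma>: "\<bar>\<sigma>\<bar> = 1"
  shows "(\<lambda>n. \<integral>t. \<phi> t / (of_real (x - t) - \<i> * of_real (\<sigma> * \<epsilon> n)) \<partial>lborel)
      \<longlonglongrightarrow> pv x + \<i> * of_real (\<sigma> * pi) * \<phi> x"
    and "norm (\<integral>t. \<phi> t / (of_real (x - t) - \<i> * of_real (\<sigma> * \<epsilon> n)) \<partial>lborel) \<le> pv_bound + B * pi"
proof -
  have pos: "s\<^sup>2 + (\<epsilon> n)\<^sup>2 > 0" for s n using \<epsilon>(1)[of n] by (simp add: add_nonneg_pos)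
  note tp = tendsto_pv[where k="\<lambda>n s. s / (s\<^sup>2 + (\<epsilon> n)\<^sup>2)" and C="\<lambda>n. 1 / \<epsilon> n"]
  note e1 = abs_conjugate_kernel_le[OF \<epsilon>(1)]
  have e2: "\<bar>s * (s / (s\<^sup>2 + (\<epsilon> n)\<^sup>2))\<bar> \<le> 1" for s n
    using pos[of s n] by (simp add: divide_simps power2_eq_square)
  have e3: "(\<lambda>n. s * (s / (s\<^sup>2 + (\<epsilon> n)\<^sup>2))) \<longlonglongrightarrow> 1" if "s \<noteq> 0" for s
  proof -
    have "(\<lambda>n. s * (s / (s\<^sup>2 + (\<epsilon> n)\<^sup>2))) \<longlonglongrightarrow> s * (s / (s\<^sup>2 + 0\<^sup>2))"
      using that by (intro tendsto_intros \<epsilon>(2)) simp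
    then show ?thesis using that by (simp add: power2_eq_square)
  qed
  have T1: "(\<lambda>n. \<integral>s. \<phi> (x - s) * of_real (s / (s\<^sup>2 + (\<epsilon> n)\<^sup>2)) \<partial>lborel) \<longlonglongrightarrow> pv x"
    and B1: "norm (\<integral>s. \<phi> (x - s) * of_real (s / (s\<^sup>2 + (\<epsilon> n)\<^sup>2)) \<partial>lborel) \<le> pv_bound" for n
    by (rule tp; use e1 e2 e3 in simp)+
  have dom: "norm (\<phi> (x - \<epsilon> n * u) * of_real (inverse (1 + u\<^sup>2))) \<le> B * inverse (1 + u\<^sup>2)" for n u
    unfolding norm_mult norm_of_real by (auto intro!: mult_mono bounded B_nonneg)
  have intB: "integrable lborel (\<lambda>u. B * inverse (1 + u\<^sup>2))"
    using integrable_lborel_inverse_1_plus_square by simp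
  have isC: "isCont \<phi> x"
  proof -
    have "L-lipschitz_on UNIV \<phi>"
      by (rule lipschitz_onI) (use lipschitz L_nonneg in \<open>auto simp: dist_norm\<close>)
    then have "continuous_on UNIV \<phi>" by (rule lipschitz_on_continuous_on)
    then show ?thesis by (simp add: continuous_on_eq_continuous_at)
  qed
  have T2: "(\<lambda>n. \<integral>u. \<phi> (x - \<epsilon> n * u) * of_real (inverse (1 + u\<^sup>2)) \<partial>lborel)
      \<longlonglongrightarrow> (\<integral>u. \<phi> x * of_real (inverse (1 + u\<^sup>2)) \<partial>lborel)"
  proof (rule integral_dominated_convergence[OF _ _ intB])
    show "AE u in lborel. (\<lambda>n. \<phi> (x - \<epsilon> n * u) * of_real (inverse (1 + u\<^sup>2)))
        \<longlonglongrightarrow> \<phi> x * of_real (inverse (1 + u\<^sup>2))"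
    proof (rule AE_I2)
      fix u
      have "(\<lambda>n. x - \<epsilon> n * u) \<longlonglongrightarrow> x - 0 * u" by (intro tendsto_intros \<epsilon>(2))
      then show "(\<lambda>n. \<phi> (x - \<epsilon> n * u) * of_real (inverse (1 + u\<^sup>2))) \<longlonglongrightarrow> \<phi> x * of_real (inverse (1 + u\<^sup>2))"
        by (intro tendsto_mult tendsto_const isCont_tendsto_compose[OF isC]) simp
    qed
  qed (use dom in auto)
  have I2: "(\<integral>u. \<phi> x * of_real (inverse (1 + u\<^sup>2)) \<partial>lborel) = \<phi> x * of_real pi"
    by (subst integral_mult_right_zero, subst integral_complex_of_real)
      (simp add: integral_lborel_inverse_1_plus_square)
  show "(\<lambda>n. \<integral>t. \<phi> t / (of_real (x - t) - \<i> * of_real (\<sigma> * \<epsilon> n)) \<partial>lborel)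
      \<longlonglongrightarrow> pv x + \<i> * of_real (\<sigma> * pi) * \<phi> x"
    unfolding Cauchy_integral_eq[OF \<epsilon>(1) \<sigma>]
    using tendsto_add[OF T1 tendsto_mult[OF tendsto_const[of "\<i> * of_real \<sigma>"] T2]]
    unfolding I2 by (simp only: of_real_mult mult_ac)
  have B2: "norm (\<integral>u. \<phi> (x - \<epsilon> n * u) * of_real (inverse (1 + u\<^sup>2)) \<partial>lborel) \<le> B * pi" for n
  proof -
    have "norm (\<integral>u. \<phi> (x - \<epsilon> n * u) * of_real (inverse (1 + u\<^sup>2)) \<partial>lborel) \<le> (\<integral>u. B * inverse (1 + u\<^sup>2) \<partial>lborel)"
    proof (rule Bochner_Integration.integral_norm_bound_integral)
      show "integrable lborel (\<lambda>u. \<phi> (x - \<epsilon> n * u) * of_real (inverse (1 + u\<^sup>2)))"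
        by (rule Bochner_Integration.integrable_bound[OF intB], measurable)
          (rule AE_I2, rule order_trans[OF dom], simp)
    qed (use dom intB in auto)
    then show ?thesis using integral_lborel_inverse_1_plus_square by simp
  qed
  have "norm (\<i> * of_real \<sigma> * (\<integral>u. \<phi> (x - \<epsilon> n * u) * of_real (inverse (1 + u\<^sup>2)) \<partial>lborel)) \<le> B * pi" for n
    using B2[of n] \<sigma> by (simp add: norm_mult del: of_real_inverse)
  then show "norm (\<integral>t. \<phi> t / (of_real (x - t) - \<i> * of_real (\<sigma> * \<epsilon> n)) \<partial>lborel) \<le> pv_bound + B * pi"
    unfolding Cauchy_integral_eq[OF \<epsilon>(1) \<sigma>] using B1[of n] by (intro norm_triangle_mono)
qed

lemma pv_measurable [measurable]: "pv \<in> borel_measurable borel"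
proof (rule borel_measurable_LIMSEQ_metric)
  let ?K = "\<lambda>n x. \<integral>t. \<phi> t / (of_real (x - t) - \<i> * of_real (1 * inverse (real (Suc n)))) \<partial>lborel"
  show "(\<lambda>n. ?K n x - \<i> * of_real (1 * pi) * \<phi> x) \<longlonglongrightarrow> pv x" for x
    using tendsto_diff[OF Plemelj(1)[of "\<lambda>n. inverse (real (Suc n))" 1 x, OF _ LIMSEQ_inverse_real_of_nat]
        tendsto_const[of "\<i> * of_real (1 * pi) * \<phi> x"]] by simp
  show "(\<lambda>x. ?K n x - \<i> * of_real (1 * pi) * \<phi> x) \<in> borel_measurable borel" for n
    by measurable
qed

lemma norm_pv_le: "norm (pv x) \<le> pv_bound"
proof -
  have "norm (\<integral>s. diffquot x s \<partial>lborel) \<le> (\<integral>s. dominator x s \<partial>lborel)"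
  proof (rule Bochner_Integration.integral_norm_bound_integral)
    show "integrable lborel (diffquot x)"
      by (rule Bochner_Integration.integrable_bound[OF integrable_dominator[of x]], measurable)
        (rule AE_I2, rule order_trans[OF norm_diffquot_le], simp)
  qed (use norm_diffquot_le integrable_dominator in auto)
  then show ?thesis by (simp add: integral_dominator pv_def norm_mult)
qed

lemma hilbert_measurable: "hilbert \<phi> \<in> borel_measurable borel"
  unfolding hilbert_eq_pv[abs_def] by measurable

lemma norm_hilbert_le: "norm (hilbert \<phi> x) \<le> pv_bound / pi"
  using norm_pv_le[of x] by (simp add: hilbert_eq_pv norm_divide divide_right_mono)

text \<open>
  The hypothesis \<open>zero\<close> says that the Cauchy integral of \<open>F\<close> vanishes on one side of the line.
  Integrating it against \<open>\<phi>\<close>, exchanging the integrals and letting \<open>\<epsilon> \<rightarrow> 0\<close> yields the result by the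
  Plemelj formula for \<open>\<phi>\<close>, so that nothing about the boundary behaviour of \<open>F\<close> is needed.
\<close>

lemma integral_mult_hilbert:
  fixes F :: "real \<Rightarrow> complex" and \<sigma> :: real
  assumes F: "integrable lborel F" and \<sigma>: "\<bar>\<sigma>\<bar> = 1"
    and zero: "\<And>t \<epsilon>. \<epsilon> > 0 \<Longrightarrow>
      (\<integral>x. F x / (of_real (x - t) - \<i> * of_real (\<sigma> * \<epsilon>)) \<partial>lborel) = 0"
  shows "(\<integral>x. F x * hilbert \<phi> x \<partial>lborel) = - \<i> * of_real \<sigma> * (\<integral>x. F x * \<phi> x \<partial>lborel)"
proof -
  have Fm [measurable]: "F \<in> borel_measurable borel" using F by simp
  define \<epsilon> where "\<epsilon> n = inverse (real (Suc n))" for n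
  have \<epsilon>: "\<epsilon> n > 0" "\<epsilon> \<longlonglongrightarrow> 0" for n
    unfolding \<epsilon>_def using LIMSEQ_inverse_real_of_nat by auto
  define k where "k n x t = inverse (of_real (x - t) - \<i> * of_real (\<sigma> * \<epsilon> n))" for n and x t :: real
  have k_meas [measurable]: "(\<lambda>p. k n (fst p) (snd p)) \<in> borel_measurable (lborel \<Otimes>\<^sub>M lborel)" for n
    unfolding k_def by measurable
  have k_bound: "norm (k n x t) \<le> 1 / \<epsilon> n" for n x t
  proof -
    have "\<epsilon> n = \<bar>Im (of_real (x - t) - \<i> * of_real (\<sigma> * \<epsilon> n))\<bar>"
      using \<sigma> \<epsilon>(1)[of n] by (simp add: abs_mult)
    also have "\<dots> \<le> norm (of_real (x - t) - \<i> * of_real (\<sigma> * \<epsilon> n))" by (rule abs_Im_le_cmod)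
    finally show ?thesis
      using \<epsilon>(1)[of n] by (simp add: k_def norm_inverse inverse_eq_divide[symmetric] le_imp_inverse_le)
  qed
  have prod: "integrable (lborel \<Otimes>\<^sub>M lborel) (\<lambda>p. F (fst p) * \<phi> (snd p))"
  proof (rule lborel_pair.Fubini_integrable)
    show "integrable lborel (\<lambda>x. \<integral>y. norm (F (fst (x, y)) * \<phi> (snd (x, y))) \<partial>lborel)"
      using F by (simp add: norm_mult)
    show "AE x in lborel. integrable lborel (\<lambda>y. F (fst (x, y)) * \<phi> (snd (x, y)))"
      using integrable by simp
  qed measurable
  have kint: "integrable (lborel \<Otimes>\<^sub>M lborel) (\<lambda>(x, t). F x * (\<phi> t * k n x t))" for n
    using integrable_mult_bounded[OF prod k_meas k_bound, of n] by (simp only: case_prod_unfold mult.assoc)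
  let ?K = "\<lambda>n x. \<integral>t. \<phi> t / (of_real (x - t) - \<i> * of_real (\<sigma> * \<epsilon> n)) \<partial>lborel"
  have K: "?K n x = (\<integral>t. \<phi> t * k n x t \<partial>lborel)" for n x
    by (simp add: k_def divide_inverse)
  have FK: "(\<integral>x. F x * ?K n x \<partial>lborel) = 0" for n
  proof -
    have "(\<integral>x. F x * ?K n x \<partial>lborel) = (\<integral>x. (\<integral>t. F x * (\<phi> t * k n x t) \<partial>lborel) \<partial>lborel)"
      unfolding K by simp
    also have "\<dots> = (\<integral>t. (\<integral>x. F x * (\<phi> t * k n x t) \<partial>lborel) \<partial>lborel)"
      by (rule lborel_pair.Fubini_integral[OF kint, symmetric])
    also have "\<dots> = (\<integral>t. \<phi> t * (\<integral>x. F x / (of_real (x - t) - \<i> * of_real (\<sigma> * \<epsilon> n)) \<partial>lborel) \<partial>lborel)"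
      unfolding k_def divide_inverse integral_mult_right_zero[symmetric] by (simp only: mult_ac)
    also have "\<dots> = 0" unfolding zero[OF \<epsilon>(1)] by simp
    finally show ?thesis .
  qed
  have K_meas [measurable]: "?K n \<in> borel_measurable borel" for n by measurable
  \<comment> \<open>The uniform bound in \<open>Plemelj\<close> makes a multiple of
    \<open>norm (F x)\<close> a dominating function, so the limit may be taken under the
    integral.\<close>
  have "(\<lambda>n. \<integral>x. F x * ?K n x \<partial>lborel)
      \<longlonglongrightarrow> (\<integral>x. F x * (pv x + \<i> * of_real (\<sigma> * pi) * \<phi> x) \<partial>lborel)"
  proof (rule integral_dominated_convergence[where w="\<lambda>x. norm (F x) * (pv_bound + B * pi)"])
    show "AE x in lborel. (\<lambda>n. F x * ?K n x) \<longlonglongrightarrow> F x * (pv x + \<i> * of_real (\<sigma> * pi) * \<phi> x)"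
      by (intro AE_I2 tendsto_mult tendsto_const Plemelj(1) \<epsilon> \<sigma>)
    show "AE x in lborel. norm (F x * ?K n x) \<le> norm (F x) * (pv_bound + B * pi)" for n
      unfolding norm_mult by (intro AE_I2 mult_left_mono Plemelj(2)[OF \<epsilon> \<sigma>] norm_ge_zero)
    show "integrable lborel (\<lambda>x. norm (F x) * (pv_bound + B * pi))" using F by simp
  qed measurable
  then have "(\<lambda>n::nat. 0::complex) \<longlonglongrightarrow> (\<integral>x. F x * (pv x + \<i> * of_real (\<sigma> * pi) * \<phi> x) \<partial>lborel)"
    unfolding FK .
  then have "0 = (\<integral>x. F x * (pv x + \<i> * of_real (\<sigma> * pi) * \<phi> x) \<partial>lborel)"
    by (rule LIMSEQ_unique[OF tendsto_const])
  also have "\<dots> = (\<integral>x. F x * pv x + \<i> * of_real (\<sigma> * pi) * (F x * \<phi> x) \<partial>lborel)"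
    by (simp only: distrib_left mult_ac)
  also have "\<dots> = (\<integral>x. F x * pv x \<partial>lborel) + \<i> * of_real (\<sigma> * pi) * (\<integral>x. F x * \<phi> x \<partial>lborel)"
  proof -
    have "integrable lborel (\<lambda>x. F x * pv x)" "integrable lborel (\<lambda>x. F x * \<phi> x)"
      using integrable_mult_bounded[OF F _ norm_pv_le] integrable_mult_bounded[OF F _ bounded] by simp_all
    then show ?thesis by simp
  qed
  finally have *: "(\<integral>x. F x * pv x \<partial>lborel) = - \<i> * of_real (\<sigma> * pi) * (\<integral>x. F x * \<phi> x \<partial>lborel)"
    by (simp add: eq_neg_iff_add_eq_0)
  have "(\<integral>x. F x * hilbert \<phi> x \<partial>lborel) = (\<integral>x. F x * pv x \<partial>lborel) / of_real pi"
    by (simp add: hilbert_eq_pv)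
  then show ?thesis unfolding * by simp
qed

end

text \<open>By transposition the Hilbert transform of \<open>F\<close> pairs with \<phi> to minus
  the integral of \<open>F\<close> times \<open>hilbert \<phi>\<close>, that is, to
  \<open>\<i> * \<sigma>\<close> times the integral of \<open>F * \<phi>\<close>. So the transform
  has density \<open>\<i> * \<sigma> * F\<close>, again integrable with integral 0.\<close>

lemma hyperbola_measure_ACH:
  fixes \<sigma> :: real
  assumes "m > 0" and F: "integrable lborel F" and F0: "(\<integral>x. F x \<partial>lborel) = 0" and \<sigma>: "\<bar>\<sigma>\<bar> = 1"
    and zero: "\<And>t \<epsilon>. \<epsilon> > 0 \<Longrightarrow>
      (\<integral>x. F x / (of_real (x - t) - \<i> * of_real (\<sigma> * \<epsilon>)) \<partial>lborel) = 0"
  shows "hyperbola_measure m F \<in> ACH m"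
proof -
  let ?G = "\<lambda>x. \<i> * of_real \<sigma> * F x"
  have G: "integrable lborel ?G" using F by simp
  have "is_hilbert_Gamma (hyperbola_measure m F) (hyperbola_measure m ?G)"
    unfolding is_hilbert_Gamma_def
  proof (intro allI impI)
    fix \<phi> assume "test_function \<phi>"
    then obtain L B where "lipschitz_L1 \<phi> L B" by (rule test_function_lipschitz_L1)
    then interpret lipschitz_L1 \<phi> L B .
    have "complex_integral (compression (hyperbola_measure m ?G)) \<phi> = (\<integral>x. ?G x * \<phi> x \<partial>lborel)"
      by (rule complex_integral_compression_hyperbola_measure[OF G measurable bounded])
    also have "\<dots> = \<i> * of_real \<sigma> * (\<integral>x. F x * \<phi> x \<partial>lborel)"
      by (simp add: mult.assoc)
    also have "\<dots> = - (\<integral>x. F x * hilbert \<phi> x \<partial>lborel)"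
      using integral_mult_hilbert[OF F \<sigma> zero] by simp
    also have "\<dots> = hilbert_distr (compression (hyperbola_measure m F)) \<phi>"
      unfolding hilbert_distr_def
      by (subst complex_integral_compression_hyperbola_measure[OF F hilbert_measurable norm_hilbert_le]) simp
    finally show "complex_integral (compression (hyperbola_measure m ?G)) \<phi> =
        hilbert_distr (compression (hyperbola_measure m F)) \<phi>" .
  qed
  moreover have "hyperbola_measure m F \<in> AC0 m" by (rule hyperbola_measure_AC0) fact+
  moreover have "hyperbola_measure m ?G \<in> AC0 m"
    by (rule hyperbola_measure_AC0[OF \<open>m > 0\<close> G]) (simp add: F0)
  ultimately show ?thesis unfolding ACH_def by blast
qed

section \<open>The band-limited Hardy space density and its vanishing integrals\<close>

definition bandlimited :: "real \<Rightarrow> complex \<Rightarrow> complex" where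
  "bandlimited b z = ((1 - exp (- \<i> * of_real b * z)) / z)\<^sup>2"

text \<open>\<open>exp\<close> and its derivative have modulus at most 1 on the closed left
  half-plane, which is convex. The first bound is sharp enough near 0, the second far away.\<close>

lemma norm_1_minus_exp_le:
  fixes w :: complex
  assumes "Re w \<le> 0"
  shows "norm (1 - exp w) \<le> norm w" "norm (1 - exp w) \<le> 2"
proof -
  have "norm (exp 0 - exp w) \<le> 1 * norm (0 - w)"
    by (rule field_differentiable_bound[of "{z. Re z \<le> 0}" exp exp])
      (use assms in \<open>auto intro!: derivative_eq_intros convex_halfspace_Re_le\<close>)
  then show "norm (1 - exp w) \<le> norm w" by simp
  have "norm (1 - exp w) \<le> norm (1::complex) + norm (exp w)" by (rule norm_triangle_ineq4)
  also have "\<dots> \<le> 2" using assms by simp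
  finally show "norm (1 - exp w) \<le> 2" .
qed

text \<open>The linear bound on \<open>1 - exp w\<close> gives \<open>b\<^sup>2\<close> everywhere,
  the constant bound gives \<open>4 / (norm z)\<^sup>2\<close>; the constant
  \<open>b\<^sup>2 + 4\<close> adds up the two.\<close>

lemma norm_bandlimited_le:
  assumes "b > 0" "Im z \<le> 0"
  shows "norm (bandlimited b z) \<le> (b\<^sup>2 + 4) / (1 + (norm z)\<^sup>2)"
proof -
  let ?w = "- \<i> * of_real b * z"
  have re: "Re ?w \<le> 0" using assms by (simp add: mult_nonneg_nonpos)
  have w: "norm ?w = b * norm z" using assms by (simp add: norm_mult)
  define r where "r = norm (1 - exp ?w)"
  have r: "0 \<le> r" "r \<le> b * norm z" "r \<le> 2"
    using norm_1_minus_exp_le[OF re] unfolding w r_def by auto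
  have k: "norm (bandlimited b z) = (r / norm z)\<^sup>2"
    by (simp add: bandlimited_def r_def norm_power norm_divide)
  have "(r / norm z)\<^sup>2 \<le> b\<^sup>2"
    using r assms by (intro power_mono) (auto simp: divide_simps)
  moreover have "(r / norm z)\<^sup>2 * (norm z)\<^sup>2 \<le> 2\<^sup>2"
    using power_mono[OF r(3,1), of 2] by (cases "z = 0") (auto simp: power_divide)
  ultimately have "norm (bandlimited b z) * (1 + (norm z)\<^sup>2) \<le> b\<^sup>2 + 4"
    unfolding k by (simp add: distrib_left)
  then show ?thesis by (simp add: pos_le_divide_eq add_pos_nonneg)
qed

lemma bandlimited_measurable [measurable]: "(\<lambda>x::real. bandlimited b (of_real x)) \<in> borel_measurable borel"
  unfolding bandlimited_def by measurable

lemma integrable_bandlimited: "b > 0 \<Longrightarrow> integrable lborel (\<lambda>x. bandlimited b (of_real x))"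
  by (rule integrable_bounded_by_Cauchy_kernel[OF bandlimited_measurable])
    (use norm_bandlimited_le[of b "of_real _"] in simp)

text \<open>The density annihilates every bounded holomorphic function on the lower half-plane with
  suitable boundary values. The vanishing results that follow rest on the choices 1, a Cauchy
  kernel, \<open>exp (\<i> * a / z)\<close> and \<open>exp (- \<i> * c * z)\<close> for
  \<open>h\<close>.\<close>

lemma integral_bandlimited_mult_eq_0:
  fixes h :: "complex \<Rightarrow> complex"
  assumes "b > 0" and h: "h holomorphic_on {z. Im z < 0}"
    and bound: "\<And>z. Im z < 0 \<Longrightarrow> norm (h z) \<le> M"
    and cont: "\<And>x::real. x \<noteq> 0 \<Longrightarrow> isCont h (of_real x)"
    and meas: "(\<lambda>x::real. h (of_real x)) \<in> borel_measurable borel"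
  shows "(\<integral>x. bandlimited b (of_real x) * h (of_real x) \<partial>lborel) = 0"
proof (rule lower_half_plane_boundary_integral_eq_0[where g="\<lambda>z. bandlimited b z * h z"])
  show "(\<lambda>z. bandlimited b z * h z) holomorphic_on {z. Im z < 0}"
    unfolding bandlimited_def by (intro holomorphic_intros h) auto
  show "norm (bandlimited b z * h z) \<le> ((b\<^sup>2 + 4) * M) / (1 + (norm z)\<^sup>2)" if "Im z < 0" for z
  proof -
    have "norm (bandlimited b z * h z) \<le> (b\<^sup>2 + 4) / (1 + (norm z)\<^sup>2) * M"
      unfolding norm_mult using norm_bandlimited_le[of b z] bound[OF that] that \<open>b > 0\<close>
      by (intro mult_mono) auto
    then show ?thesis by simp
  qed
  \<comment> \<open>At 0 division by zero gives \<open>bandlimited\<close> the value 0, whereas its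
    limit there is \<open>- b\<^sup>2\<close>; continuity is claimed only away from 0.\<close>
  show "isCont (\<lambda>z. bandlimited b z * h z) (of_real x)" if "x \<noteq> 0" for x
    unfolding bandlimited_def using that cont[OF that] by (intro continuous_intros) auto
qed (use meas in measurable)

lemma integral_bandlimited_eq_0: "b > 0 \<Longrightarrow> (\<integral>x. bandlimited b (of_real x) \<partial>lborel) = 0"
  using integral_bandlimited_mult_eq_0[of b "\<lambda>_. 1" 1] by simp

text \<open>The pole \<open>t + \<i> * \<epsilon>\<close> lies in the upper half-plane, so on the
  lower one the kernel is holomorphic and bounded by \<open>1 / \<epsilon>\<close>.\<close>

lemma integral_bandlimited_Cauchy_eq_0:
  assumes "b > 0" "\<epsilon> > 0"
  shows "(\<integral>x. bandlimited b (of_real x) / (of_real (x - t) - \<i> * of_real \<epsilon>) \<partial>lborel) = 0"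
proof -
  have ne: "z - of_real t - \<i> * of_real \<epsilon> \<noteq> 0" if "Im z \<le> 0" for z
    using that \<open>\<epsilon> > 0\<close> by (auto simp: complex_eq_iff)
  have "(\<integral>x. bandlimited b (of_real x) * inverse (of_real x - of_real t - \<i> * of_real \<epsilon>) \<partial>lborel) = 0"
  proof (rule integral_bandlimited_mult_eq_0[where h="\<lambda>z. inverse (z - of_real t - \<i> * of_real \<epsilon>)" and M="inverse \<epsilon>"])
    show "(\<lambda>z. inverse (z - of_real t - \<i> * of_real \<epsilon>)) holomorphic_on {z. Im z < 0}"
      using ne by (intro holomorphic_intros) auto
    show "norm (inverse (z - of_real t - \<i> * of_real \<epsilon>)) \<le> inverse \<epsilon>" if "Im z < 0" for z
    proof -
      have "\<epsilon> \<le> \<bar>Im (z - of_real t - \<i> * of_real \<epsilon>)\<bar>" using that \<open>\<epsilon> > 0\<close> by simp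
      also have "\<dots> \<le> norm (z - of_real t - \<i> * of_real \<epsilon>)" by (rule abs_Im_le_cmod)
      finally show ?thesis unfolding norm_inverse using \<open>\<epsilon> > 0\<close> by (rule le_imp_inverse_le)
    qed
    show "isCont (\<lambda>z. inverse (z - of_real t - \<i> * of_real \<epsilon>)) (of_real x)" for x
      using ne[of "of_real x"] by (intro continuous_intros) simp_all
  qed (use assms in auto)
  then show ?thesis by (simp add: divide_inverse)
qed

text \<open>Inversion maps the lower half-plane to the upper one, where
  \<open>exp (\<i> * a * w)\<close> has modulus at most 1. This settles the second axis of the
  lattice-cross.\<close>

lemma integral_bandlimited_exp_inverse_eq_0:
  assumes "b > 0" "a \<ge> 0"
  shows "(\<integral>x. bandlimited b (of_real x) * exp (\<i> * of_real (a / x)) \<partial>lborel) = 0"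
proof -
  have "(\<integral>x. bandlimited b (of_real x) * exp (\<i> * (of_real a / of_real x)) \<partial>lborel) = 0"
  proof (rule integral_bandlimited_mult_eq_0[where h="\<lambda>z. exp (\<i> * (of_real a / z))" and M=1])
    show "(\<lambda>z. exp (\<i> * (of_real a / z))) holomorphic_on {z. Im z < 0}"
      by (intro holomorphic_intros) auto
    show "norm (exp (\<i> * (of_real a / z))) \<le> 1" if "Im z < 0" for z
      using that assms by (simp add: Re_divide divide_nonpos_nonneg mult_nonneg_nonpos)
    show "isCont (\<lambda>z. exp (\<i> * (of_real a / z))) (of_real x)" if "x \<noteq> 0" for x
      using that by (intro continuous_intros) auto
  qed (use assms in auto)
  then show ?thesis by simp
qed

lemma integral_bandlimited_exp_uminus_eq_0:
  assumes "b > 0" "c \<ge> 0"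
  shows "(\<integral>x. bandlimited b (of_real x) * exp (- \<i> * of_real (c * x)) \<partial>lborel) = 0"
proof -
  have "(\<integral>x. bandlimited b (of_real x) * exp (- \<i> * of_real c * of_real x) \<partial>lborel) = 0"
  proof (rule integral_bandlimited_mult_eq_0[where h="\<lambda>z. exp (- \<i> * of_real c * z)" and M=1])
    show "norm (exp (- \<i> * of_real c * z)) \<le> 1" if "Im z < 0" for z
      using that assms by (simp add: mult_nonneg_nonpos)
  qed (use assms in \<open>auto intro!: holomorphic_intros continuous_intros\<close>)
  then show ?thesis by (simp add: mult.assoc)
qed

text \<open>Pulling \<open>- exp (\<i> * b * z)\<close> out of \<open>1 - exp (\<i> * b * z)\<close>
  leaves \<open>1 - exp (- \<i> * b * z)\<close>, and squaring removes the signs. On the Fourier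
  side this is the symmetry of the triangle about its peak at frequency \<open>b\<close>.\<close>

lemma bandlimited_uminus: "bandlimited b (- z) = bandlimited b z * exp (2 * \<i> * of_real b * z)"
proof -
  define e where "e = exp (\<i> * of_real b * z)"
  have "e \<noteq> 0" by (simp add: e_def)
  have 1: "exp (- \<i> * of_real b * z) = 1 / e" "exp (- \<i> * of_real b * (- z)) = e"
    by (simp_all add: e_def exp_minus divide_inverse)
  have 2: "exp (2 * \<i> * of_real b * z) = e\<^sup>2"
    unfolding e_def exp_double[symmetric] by (simp add: mult.assoc)
  have "(1 - e)\<^sup>2 = (1 - 1 / e)\<^sup>2 * e\<^sup>2"
    using \<open>e \<noteq> 0\<close> by (simp add: power_mult_distrib[symmetric] left_diff_distrib power2_commute)
  then show ?thesis
    unfolding bandlimited_def 1 2 by (simp add: power_divide)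
qed

text \<open>Reflecting \<open>x\<close> turns the frequency \<open>c\<close> into
  \<open>2 * b - c\<close>, which is at most 0 and hence covered by the preceding vanishing
  result.\<close>

lemma integral_bandlimited_exp_eq_0:
  assumes "b > 0" "c \<ge> 2 * b"
  shows "(\<integral>x. bandlimited b (of_real x) * exp (\<i> * of_real (c * x)) \<partial>lborel) = 0"
proof -
  have "(\<integral>x. bandlimited b (of_real x) * exp (\<i> * of_real (c * x)) \<partial>lborel)
      = (\<integral>x. bandlimited b (of_real x) * exp (- \<i> * of_real ((c - 2 * b) * x)) \<partial>lborel)"
  proof (subst lborel_integral_real_affine[of "-1" _ 0])
    have "bandlimited b (of_real (0 + - 1 * x)) * exp (\<i> * of_real (c * (0 + - 1 * x)))
        = bandlimited b (of_real x) * exp (- \<i> * of_real ((c - 2 * b) * x))" for x :: real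
      by (simp add: bandlimited_uminus mult_exp_exp algebra_simps)
    then show "\<bar>- 1\<bar> *\<^sub>R (\<integral>x. bandlimited b (of_real (0 + - 1 * x)) * exp (\<i> * of_real (c * (0 + - 1 * x))) \<partial>lborel)
        = (\<integral>x. bandlimited b (of_real x) * exp (- \<i> * of_real ((c - 2 * b) * x)) \<partial>lborel)"
      by simp
  qed simp
  also have "\<dots> = 0" using assms by (intro integral_bandlimited_exp_uminus_eq_0) auto
  finally show ?thesis .
qed

text \<open>At the peak frequency \<open>b\<close> the integrand is minus the square of
  \<open>2 * sin (b * x / 2) / x\<close>, so a zero integral would force it to vanish almost
  everywhere.\<close>

lemma integral_bandlimited_exp_neq_0:
  assumes "b > 0"
  shows "(\<integral>x. bandlimited b (of_real x) * exp (\<i> * of_real (b * x)) \<partial>lborel) \<noteq> 0"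
proof
  let ?g = "\<lambda>x::real. (2 * sin (b * x / 2) / x)\<^sup>2"
  have eq: "bandlimited b (of_real x) * exp (\<i> * of_real (b * x)) = of_real (- ?g x)" for x
  proof -
    define u where "u = exp (\<i> * of_real (b * x / 2))"
    have u0: "u \<noteq> 0" by (simp add: u_def)
    have 1: "exp (\<i> * of_real (b * x)) = u\<^sup>2"
      unfolding u_def exp_double[symmetric] by simp
    have 2: "exp (- \<i> * of_real b * of_real x) = 1 / u\<^sup>2"
      unfolding 1[symmetric] by (simp add: exp_minus divide_inverse mult.assoc)
    have "of_real (sin (b * x / 2)) = sin (complex_of_real (b * x / 2))"
      by (rule sin_of_real[symmetric])
    also have "\<dots> = (u - 1 / u) / (2 * \<i>)"
      unfolding sin_exp_eq u_def by (simp only: exp_minus inverse_eq_divide mult_minus_left mult_minus_right)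
    finally have "complex_of_real (- ?g x) = - (2 * ((u - 1 / u) / (2 * \<i>)) / of_real x)\<^sup>2" by simp
    also have "\<dots> = ((u - 1 / u) / of_real x)\<^sup>2"
      by (simp add: power_divide power_mult_distrib)
    also have "\<dots> = ((1 - 1 / u\<^sup>2) / of_real x)\<^sup>2 * u\<^sup>2"
      using u0 by (simp add: power_mult_distrib[symmetric] divide_simps power2_eq_square)
    finally show ?thesis unfolding bandlimited_def 1 2 by simp
  qed
  have int: "integrable lborel ?g"
  proof -
    have "integrable lborel (\<lambda>x. bandlimited b (of_real x) * exp (\<i> * of_real (b * x)))"
      by (rule integrable_mult_bounded[OF integrable_bandlimited[OF assms], where C=1]) auto
    then have "integrable lborel (\<lambda>x. - Re (bandlimited b (of_real x) * exp (\<i> * of_real (b * x))))"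
      by (intro integrable_minus integrable_Re)
    then show ?thesis unfolding eq by simp
  qed
  assume "(\<integral>x. bandlimited b (of_real x) * exp (\<i> * of_real (b * x)) \<partial>lborel) = 0"
  then have "(\<integral>x. ?g x \<partial>lborel) = 0"
    unfolding eq integral_complex_of_real by simp
  then have "AE x in lborel. ?g x = 0"
    using int by (subst (asm) integral_nonneg_eq_0_iff_AE) auto
  \<comment> \<open>On this interval \<open>b * x / 2\<close> runs through the open interval from 0
    to \<open>pi\<close>, where the sine is positive.\<close>
  then have "AE x in lborel. x \<notin> {0<..<2 * pi / b}"
  proof eventually_elim
    fix x assume "?g x = 0"
    show "x \<notin> {0<..<2 * pi / b}"
    proof
      assume x: "x \<in> {0<..<2 * pi / b}"
      then have "sin (b * x / 2) > 0" using assms by (intro sin_gt_zero) (auto simp: field_simps)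
      with \<open>?g x = 0\<close> x show False by simp
    qed
  qed
  then have "emeasure lborel {0<..<2 * pi / b} = 0"
    by (subst (asm) AE_iff_measurable[where N="{0<..<2 * pi / b}"]) auto
  then show False using assms by simp
qed

section \<open>The witness measure, its Fourier transform, and the conclusion\<close>

lemma integral_reflect:
  fixes g :: "real \<Rightarrow> complex"
  assumes "\<bar>\<sigma>\<bar> = 1"
  shows "(\<integral>x. g (\<sigma> * x) \<partial>lborel) = (\<integral>x. g x \<partial>lborel)"
  using lborel_integral_real_affine[of \<sigma> g 0] assms by auto

definition witness :: "real \<Rightarrow> real \<Rightarrow> real \<Rightarrow> (real \<times> real) set \<Rightarrow> complex" where
  "witness \<sigma> b m = hyperbola_measure m (\<lambda>x. bandlimited b (of_real (\<sigma> * x)))"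

lemma integrable_witness: "b > 0 \<Longrightarrow> \<bar>\<sigma>\<bar> = 1 \<Longrightarrow> integrable lborel (\<lambda>x. bandlimited b (of_real (\<sigma> * x)))"
  using lborel_integrable_real_affine[OF integrable_bandlimited, of b \<sigma> 0] by auto

lemma witness_ACH:
  assumes "m > 0" "b > 0" "\<bar>\<sigma>\<bar> = 1"
  shows "witness \<sigma> b m \<in> ACH m"
  unfolding witness_def
proof (rule hyperbola_measure_ACH[OF \<open>m > 0\<close> integrable_witness[OF assms(2,3)] _ assms(3)])
  show "(\<integral>x. bandlimited b (of_real (\<sigma> * x)) \<partial>lborel) = 0"
    using integral_reflect[OF assms(3), of "\<lambda>x. bandlimited b (of_real x)"] integral_bandlimited_eq_0[OF assms(2)] by simp
  fix t \<epsilon> :: real assume "\<epsilon> > 0"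
  have s2: "\<sigma> * \<sigma> = 1" using abs_mult_self_eq[of \<sigma>] assms(3) by simp
  \<comment> \<open>Factoring \<sigma> out of the denominator exhibits it in terms of
    \<open>\<sigma> * x\<close>, so that reflection moves the pole to
    \<open>\<sigma> * t + \<i> * \<epsilon>\<close>, in the upper half-plane for either
    sign.\<close>
  have *: "of_real (x - t) - \<i> * of_real (\<sigma> * \<epsilon>)
      = of_real \<sigma> * (of_real (\<sigma> * x - \<sigma> * t) - \<i> * complex_of_real \<epsilon>)" for x
  proof -
    have "of_real \<sigma> * (of_real (\<sigma> * x - \<sigma> * t) - \<i> * complex_of_real \<epsilon>)
        = of_real ((\<sigma> * \<sigma>) * (x - t)) - \<i> * complex_of_real (\<sigma> * \<epsilon>)"
      by (simp add: algebra_simps)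
    then show ?thesis unfolding s2 by simp
  qed
  have "(\<integral>x. bandlimited b (of_real (\<sigma> * x)) / (of_real (x - t) - \<i> * of_real (\<sigma> * \<epsilon>)) \<partial>lborel)
      = (\<integral>x. (bandlimited b (of_real (\<sigma> * x)) / (of_real (\<sigma> * x - \<sigma> * t) - \<i> * complex_of_real \<epsilon>)) / of_real \<sigma> \<partial>lborel)"
    unfolding * by (simp add: mult.commute)
  also have "\<dots> = (\<integral>x. bandlimited b (of_real (\<sigma> * x)) / (of_real (\<sigma> * x - \<sigma> * t) - \<i> * complex_of_real \<epsilon>) \<partial>lborel) / of_real \<sigma>"
    by (rule integral_divide_zero)
  also have "\<dots> = 0"
    by (simp only: integral_bandlimited_Cauchy_eq_0[OF assms(2) \<open>\<epsilon> > 0\<close>] div_0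
      integral_reflect[OF assms(3),
        of "\<lambda>x. bandlimited b (of_real x) / (of_real (x - \<sigma> * t) - \<i> * complex_of_real \<epsilon>)"])
  finally show "(\<integral>x. bandlimited b (of_real (\<sigma> * x)) / (of_real (x - t) - \<i> * of_real (\<sigma> * \<epsilon>)) \<partial>lborel) = 0" .
qed

text \<open>Substituting \<open>\<sigma> * x\<close> for \<open>x\<close> replaces \<xi> by
  \<open>\<sigma> * \<xi>\<close>, which brings both quadrants to the same form. The factor
  \<open>m\<^sup>2 / (4 * pi)\<close> is \<open>pi\<close> times the constant of the
  hyperbola.\<close>

lemma fourier_witness:
  assumes "b > 0" "\<bar>\<sigma>\<bar> = 1"
  shows "fourier (witness \<sigma> b m) \<xi> = (\<integral>x. bandlimited b (of_real x) *
    exp (\<i> * of_real (pi * (\<sigma> * fst \<xi>) * x + (- (m\<^sup>2 / (4 * pi) * (\<sigma> * snd \<xi>))) / x)) \<partial>lborel)"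
proof -
  have s2: "\<sigma> * \<sigma> = 1" "\<sigma> \<noteq> 0" using abs_mult_self_eq[of \<sigma>] assms(2) by auto
  have *: "pi * (t * fst \<xi> - m\<^sup>2 / (4 * pi\<^sup>2 * t) * snd \<xi>)
      = pi * (\<sigma> * fst \<xi>) * (\<sigma> * t) + (- (m\<^sup>2 / (4 * pi) * (\<sigma> * snd \<xi>))) / (\<sigma> * t)" for t
  proof -
    have "pi * (\<sigma> * fst \<xi>) * (\<sigma> * t) = (\<sigma> * \<sigma>) * (pi * (t * fst \<xi>))" by (simp add: mult_ac)
    moreover have "(- (m\<^sup>2 / (4 * pi) * (\<sigma> * snd \<xi>))) / (\<sigma> * t) = - (pi * (m\<^sup>2 / (4 * pi\<^sup>2 * t) * snd \<xi>))"
      using s2 by (simp add: power2_eq_square divide_simps)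
    ultimately show ?thesis by (simp add: s2 right_diff_distrib)
  qed
  show ?thesis
    unfolding witness_def fourier_hyperbola_measure[OF integrable_witness[OF assms]] *
    by (rule integral_reflect[OF assms(2)])
qed

theorem theorem3p8:
  fixes m \<alpha> \<beta> :: real and Q :: "(real \<times> real) set"
  assumes "m > 0" and "\<alpha> > 0" and "\<beta> > 0"
    and "Q \<in> {quadrant_pm, quadrant_mp}"
  shows "\<not> local_fourier_uniqueness_set (closure Q) (ACH m) (lattice_cross \<alpha> \<beta> \<inter> closure Q) \<and>
         \<not> fourier_uniqueness_set (ACH m) (lattice_cross \<alpha> \<beta> \<inter> closure Q)"
proof -
  obtain \<sigma> :: real where \<sigma>: "\<bar>\<sigma>\<bar> = 1" and Q: "Q = {\<xi>. 0 < \<sigma> * fst \<xi> \<and> \<sigma> * snd \<xi> < 0}"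
  proof (cases "Q = quadrant_pm")
    case True
    then show thesis by (intro that[of 1]) (auto simp: quadrant_pm_def)
  next
    case False
    with assms(4) show thesis by (intro that[of "-1"]) (auto simp: quadrant_mp_def)
  qed
  have s2: "\<sigma> * \<sigma> = 1" using abs_mult_self_eq[of \<sigma>] \<sigma> by simp
  \<comment> \<open>The frequency at \<xi> on the first axis is
    \<open>pi * \<sigma> * fst \<xi>\<close>. This \<open>b\<close> puts the end
    \<open>2 * b\<close> of the band at the first nonzero lattice point
    \<open>\<sigma> * \<alpha>\<close> and its centre \<open>b\<close> halfway to it.\<close>
  define b where "b = pi * \<alpha> / 2"
  have b: "b > 0" using \<open>\<alpha> > 0\<close> by (simp add: b_def)
  define \<mu> where "\<mu> = witness \<sigma> b m"
  have \<mu>: "\<mu> \<in> ACH m" unfolding \<mu>_def by (rule witness_ACH[OF \<open>m > 0\<close> b \<sigma>])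
  have sub: "closure Q \<subseteq> {\<xi>. 0 \<le> \<sigma> * fst \<xi> \<and> \<sigma> * snd \<xi> \<le> 0}"
    unfolding Q by (rule closure_minimal)
      (auto intro!: closed_Collect_conj closed_Collect_le continuous_intros)
  have vanish: "fourier \<mu> \<xi> = 0" if \<xi>: "\<xi> \<in> lattice_cross \<alpha> \<beta> \<inter> closure Q" for \<xi>
  proof -
    have q: "0 \<le> \<sigma> * fst \<xi>" "\<sigma> * snd \<xi> \<le> 0" using \<xi> sub by auto
    consider j :: int where "\<xi> = (\<alpha> * of_int j, 0)" | k :: int where "\<xi> = (0, \<beta> * of_int k)"
      using \<xi> unfolding lattice_cross_def by blast
    then show ?thesis
    proof cases
      case 1
      have f: "fourier \<mu> \<xi> = (\<integral>x. bandlimited b (of_real x) * exp (\<i> * of_real ((pi * (\<sigma> * (\<alpha> * of_int j))) * x)) \<partial>lborel)"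
        unfolding \<mu>_def fourier_witness[OF b \<sigma>] 1 by simp
      \<comment> \<open>The origin is handled by the vanishing total mass. Every other lattice point
        of this axis in the closed quadrant has \<open>\<sigma> * j\<close> at least 1, so its
        frequency is at or beyond the end of the band.\<close>
      show ?thesis
      proof (cases "j = 0")
        case True
        then show ?thesis unfolding f using integral_bandlimited_eq_0[OF b] by simp
      next
        case False
        have "\<alpha> * 1 \<le> \<alpha> * \<bar>of_int j\<bar>" using False \<open>\<alpha> > 0\<close> by (intro mult_left_mono) auto
        also have "\<dots> = \<bar>\<sigma> * (\<alpha> * of_int j)\<bar>" using \<sigma> \<open>\<alpha> > 0\<close> by (simp add: abs_mult)
        also have "\<dots> = \<sigma> * (\<alpha> * of_int j)" using q(1) 1 by simp
        finally have "2 * b \<le> pi * (\<sigma> * (\<alpha> * of_int j))"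
          unfolding b_def by simp
        then show ?thesis unfolding f by (rule integral_bandlimited_exp_eq_0[OF b])
      qed
    next
      case 2
      have "fourier \<mu> \<xi> = (\<integral>x. bandlimited b (of_real x) * exp (\<i> * of_real ((- (m\<^sup>2 / (4 * pi) * (\<sigma> * snd \<xi>))) / x)) \<partial>lborel)"
        unfolding \<mu>_def fourier_witness[OF b \<sigma>] 2 by simp
      also have "\<dots> = 0"
      proof (rule integral_bandlimited_exp_inverse_eq_0[OF b])
        have "m\<^sup>2 / (4 * pi) * (\<sigma> * snd \<xi>) \<le> 0" by (rule mult_nonneg_nonpos[OF _ q(2)]) simp
        then show "0 \<le> - (m\<^sup>2 / (4 * pi) * (\<sigma> * snd \<xi>))" by linarith
      qed
      finally show ?thesis .
    qed
  qed
  \<comment> \<open>The midpoint between two neighbouring lattice points on the bounding axis of the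
    quadrant, where the triangle function peaks.\<close>
  let ?\<xi> = "(\<sigma> * \<alpha> / 2, 0) :: real \<times> real"
  have mem: "?\<xi> \<in> closure Q"
    unfolding closure_approachable
  proof (intro allI impI)
    fix e :: real assume "e > 0"
    have "(\<sigma> * \<alpha> / 2, - \<sigma> * e / 2) \<in> Q"
      using s2 \<open>e > 0\<close> \<open>\<alpha> > 0\<close> by (simp add: Q mult.assoc[symmetric])
    moreover have "dist (\<sigma> * \<alpha> / 2, - \<sigma> * e / 2) ?\<xi> < e"
      using \<sigma> \<open>e > 0\<close> by (simp add: dist_Pair_Pair dist_real_def abs_mult)
    ultimately show "\<exists>y\<in>Q. dist y ?\<xi> < e" by blast
  qed
  have "pi * (\<sigma> * (\<sigma> * \<alpha> / 2)) = b" using s2 by (simp add: b_def mult.assoc[symmetric])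
  then have nz: "fourier \<mu> ?\<xi> \<noteq> 0"
    unfolding \<mu>_def fourier_witness[OF b \<sigma>] using integral_bandlimited_exp_neq_0[OF b] by simp
  have "\<mu> \<noteq> (\<lambda>_. 0)"
  proof
    assume "\<mu> = (\<lambda>_. 0)"
    \<comment> \<open>Viewing the zero measure as the one with density 0 lets
      \<open>fourier_hyperbola_measure\<close> compute its transform.\<close>
    also have "\<dots> = hyperbola_measure m (\<lambda>_. 0)"
      by (auto simp: hyperbola_measure_def set_lebesgue_integral_def)
    finally have "fourier \<mu> ?\<xi> = 0" by (simp add: fourier_hyperbola_measure)
    with nz show False by simp
  qed
  with \<mu> vanish mem nz show ?thesis
    unfolding local_fourier_uniqueness_set_def fourier_uniqueness_set_def by blast
qed

end
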